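(* Let $p$ be an odd prime and let $k\in\mathbb{N}$. Then there exist flat solvmanifolds of dimension $(p-1)p^{k-1}+1$ with holonomy group $\mathbb{Z}_{p^k}$ and $\mathbb{Z}_{2p^k}$, respectively. If $p=2$ the assertion is valid for $k\geq 2$.
   Context: A solvmanifold is a compact quotient $\Gamma\backslash G$, where $G$ is a simply connected solvable Lie group and $\Gamma$ is a lattice (discrete co-compact subgroup) of $G$. A flat solvmanifold is a solvmanifold $\Gamma\backslash G$ equipped with a flat Riemannian metric induced by a flat left invariant metric on $G$; its holonomy group is the Riemannian holonomy group of this metric (up to isomorphism). $\mathbb{N}=\{1,2,\dots\}$ and $\mathbb{Z}_n=\mathbb{Z}/n\mathbb{Z}$ denotes the cyclic group of order $n$.
   Formalization: For p=2 and k≥2 only holonomy group Z_{2^k} is asserted; the literal second half (Z_{2p^k}=Z_{2^{k+1}} in dimension 2^{k-1}+1) is false, since an integer matrix of order 2^{k+1} needs size at least 2^k. *)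

theory Defs
  imports
    "HOL-Algebra.Solvable_Groups"
    "HOL-Algebra.Elementary_Groups"
    "HOL-Computational_Algebra.Primes"
    "HOL-Analysis.Analysis"
begin

section \<open>Smooth manifolds\<close>

text \<open>For an open subset \<open>S\<close> of a finite-dimensional space this is \<open>C\<^sup>n\<close> on \<open>S\<close>: all iterated
  directional derivatives up to order \<open>n\<close> exist and are continuous.\<close>

primrec Ck_on ::
  "nat \<Rightarrow> 'e::euclidean_space set \<Rightarrow> ('e \<Rightarrow> 'f::real_normed_vector) \<Rightarrow> bool" where
  "Ck_on 0 S f \<longleftrightarrow> continuous_on S f"
| "Ck_on (Suc n) S f \<longleftrightarrow>
     (\<forall>x\<in>S. f differentiable (at x)) \<and> (\<forall>v. Ck_on n S (\<lambda>x. frechet_derivative f (at x) v))"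

definition smooth_on ::
  "'e::euclidean_space set \<Rightarrow> ('e \<Rightarrow> 'f::real_normed_vector) \<Rightarrow> bool" where
  "smooth_on S f \<longleftrightarrow> (\<forall>n. Ck_on n S f)"

text \<open>A chart is a domain \<open>U\<close> together with a coordinate map, only meaningful on \<open>U\<close>, into the model
  space \<open>'e\<close>; the dimension of a manifold modelled on \<open>'e\<close> is \<open>DIM('e)\<close>.\<close>

type_synonym ('a, 'e) chart = "'a set \<times> ('a \<Rightarrow> 'e)"

record ('a, 'e) manifold =
  top_space :: "'a topology"
  atlas :: "('a, 'e) chart set"

definition charts_at :: "('a, 'e) manifold \<Rightarrow> 'a \<Rightarrow> ('a, 'e) chart set" where
  "charts_at M x = {c \<in> atlas M. x \<in> fst c}"

definition chart_inv :: "('a, 'e) chart \<Rightarrow> 'e \<Rightarrow> 'a" where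
  "chart_inv c = inv_into (fst c) (snd c)"

definition coord_rep ::
  "('a, 'e) chart \<Rightarrow> ('b, 'f) chart \<Rightarrow> ('a \<Rightarrow> 'b) \<Rightarrow> 'e \<Rightarrow> 'f" where
  "coord_rep c d f = snd d \<circ> f \<circ> chart_inv c"

abbreviation chart_transition :: "('a, 'e) chart \<Rightarrow> ('a, 'e) chart \<Rightarrow> 'e \<Rightarrow> 'e" where
  "chart_transition c d \<equiv> coord_rep c d (\<lambda>x. x)"

definition smooth_manifold :: "('a, 'e::euclidean_space) manifold \<Rightarrow> bool" where
  "smooth_manifold M \<longleftrightarrow>
     Hausdorff_space (top_space M) \<and> second_countable (top_space M) \<and>
     topspace (top_space M) = \<Union> (fst ` atlas M) \<and>
     (\<forall>c\<in>atlas M.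
        openin (top_space M) (fst c) \<and> open (snd c ` fst c) \<and>
        homeomorphic_map (subtopology (top_space M) (fst c)) (top_of_set (snd c ` fst c)) (snd c)) \<and>
     (\<forall>c\<in>atlas M. \<forall>d\<in>atlas M. smooth_on (snd c ` (fst c \<inter> fst d)) (chart_transition c d))"

definition smooth_map ::
  "('a, 'e::euclidean_space) manifold \<Rightarrow> ('b, 'f::euclidean_space) manifold \<Rightarrow> ('a \<Rightarrow> 'b) \<Rightarrow> bool"
  where
  "smooth_map M N f \<longleftrightarrow>
     continuous_map (top_space M) (top_space N) f \<and>
     (\<forall>c\<in>atlas M. \<forall>d\<in>atlas N. smooth_on (snd c ` {x \<in> fst c. f x \<in> fst d}) (coord_rep c d f))"

definition product_manifold ::
  "('a, 'e) manifold \<Rightarrow> ('b, 'f) manifold \<Rightarrow> ('a \<times> 'b, 'e \<times> 'f) manifold" where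
  "product_manifold M N =
     \<lparr>top_space = prod_topology (top_space M) (top_space N),
      atlas = {(fst c \<times> fst d, map_prod (snd c) (snd d)) | c d. c \<in> atlas M \<and> d \<in> atlas N}\<rparr>"


section \<open>Tangent vectors\<close>

text \<open>A tangent vector at \<open>x\<close> is the family of its coordinate vectors in the charts of the atlas
  around \<open>x\<close>, related by the Jacobians of the chart transitions. The value \<open>0\<close> at charts not
  containing \<open>x\<close> is a convention which makes the representation unique.\<close>

type_synonym ('a, 'e) tvec = "('a, 'e) chart \<Rightarrow> 'e"

definition tangent_space ::
  "('a, 'e::euclidean_space) manifold \<Rightarrow> 'a \<Rightarrow> ('a, 'e) tvec set" where
  "tangent_space M x =
     {v. (\<forall>c\<in>charts_at M x. \<forall>d\<in>charts_at M x.
            v d = frechet_derivative (chart_transition c d) (at (snd c x)) (v c)) \<and>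
         (\<forall>c. c \<notin> charts_at M x \<longrightarrow> v c = 0)}"

definition tvec_of ::
  "('a, 'e::euclidean_space) manifold \<Rightarrow> 'a \<Rightarrow> ('a, 'e) chart \<Rightarrow> 'e \<Rightarrow> ('a, 'e) tvec" where
  "tvec_of M x c u =
     (\<lambda>d. if d \<in> charts_at M x
          then frechet_derivative (chart_transition c d) (at (snd c x)) u else 0)"

definition differential ::
  "('a, 'e::euclidean_space) manifold \<Rightarrow> ('b, 'f::euclidean_space) manifold \<Rightarrow> ('a \<Rightarrow> 'b) \<Rightarrow>
   'a \<Rightarrow> ('a, 'e) tvec \<Rightarrow> ('b, 'f) tvec" where
  "differential M N f x v =
     (let c = (SOME c. c \<in> charts_at M x) in
      (\<lambda>d. if d \<in> charts_at N (f x)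
           then frechet_derivative (coord_rep c d f) (at (snd c x)) (v c) else 0))"


section \<open>Riemannian metrics, Levi-Civita connection and curvature\<close>

type_synonym ('a, 'e) metric_tensor = "'a \<Rightarrow> ('a, 'e) tvec \<Rightarrow> ('a, 'e) tvec \<Rightarrow> real"

text \<open>The coefficients \<open>g(u, w)\<close> in the chart \<open>c\<close>, at the point with coordinates \<open>z\<close>, of the
  coordinate vectors \<open>u\<close> and \<open>w\<close>.\<close>

definition metric_coeff ::
  "('a, 'e::euclidean_space) manifold \<Rightarrow> ('a, 'e) metric_tensor \<Rightarrow> ('a, 'e) chart \<Rightarrow>
   'e \<Rightarrow> 'e \<Rightarrow> 'e \<Rightarrow> real" where
  "metric_coeff M g c z u w =
     g (chart_inv c z) (tvec_of M (chart_inv c z) c u) (tvec_of M (chart_inv c z) c w)"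

definition riemannian_metric ::
  "('a, 'e::euclidean_space) manifold \<Rightarrow> ('a, 'e) metric_tensor \<Rightarrow> bool" where
  "riemannian_metric M g \<longleftrightarrow>
     (\<forall>x\<in>topspace (top_space M).
        (\<forall>v\<in>tangent_space M x. \<forall>w\<in>tangent_space M x.
           g x v w = g x w v \<and>
           (\<forall>r. g x (\<lambda>c. r *\<^sub>R v c) w = r * g x v w) \<and>
           (\<forall>v'\<in>tangent_space M x. g x (\<lambda>c. v c + v' c) w = g x v w + g x v' w)) \<and>
        (\<forall>v\<in>tangent_space M x. v \<noteq> (\<lambda>c. 0) \<longrightarrow> 0 < g x v v)) \<and>
     (\<forall>c\<in>atlas M. \<forall>u w. smooth_on (snd c ` fst c) (\<lambda>z. metric_coeff M g c z u w))"

text \<open>\<open>christoffel M g c z u v\<close> is the coordinate expression of \<open>\<nabla>\<^sub>u v\<close> for the constant coordinate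
  fields \<open>u\<close> and \<open>v\<close>, that is, \<open>\<Gamma>\<^sup>k\<^sub>i\<^sub>j u\<^sup>i v\<^sup>j\<close>, characterised by the Koszul formula.\<close>

definition christoffel ::
  "('a, 'e::euclidean_space) manifold \<Rightarrow> ('a, 'e) metric_tensor \<Rightarrow> ('a, 'e) chart \<Rightarrow>
   'e \<Rightarrow> 'e \<Rightarrow> 'e \<Rightarrow> 'e" where
  "christoffel M g c z u v =
     (THE b. \<forall>w. 2 * metric_coeff M g c z b w =
          frechet_derivative (\<lambda>y. metric_coeff M g c y v w) (at z) u
        + frechet_derivative (\<lambda>y. metric_coeff M g c y u w) (at z) v
        - frechet_derivative (\<lambda>y. metric_coeff M g c y u v) (at z) w)"

text \<open>\<open>R(u,v)w = \<nabla>\<^sub>u \<nabla>\<^sub>v w - \<nabla>\<^sub>v \<nabla>\<^sub>u w\<close> for constant coordinate fields (whose brackets vanish).\<close>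

definition curvature ::
  "('a, 'e::euclidean_space) manifold \<Rightarrow> ('a, 'e) metric_tensor \<Rightarrow> ('a, 'e) chart \<Rightarrow>
   'e \<Rightarrow> 'e \<Rightarrow> 'e \<Rightarrow> 'e \<Rightarrow> 'e" where
  "curvature M g c z u v w =
       frechet_derivative (\<lambda>y. christoffel M g c y v w) (at z) u
     - frechet_derivative (\<lambda>y. christoffel M g c y u w) (at z) v
     + christoffel M g c z u (christoffel M g c z v w)
     - christoffel M g c z v (christoffel M g c z u w)"

definition flat_metric ::
  "('a, 'e::euclidean_space) manifold \<Rightarrow> ('a, 'e) metric_tensor \<Rightarrow> bool" where
  "flat_metric M g \<longleftrightarrow>
     (\<forall>c\<in>atlas M. \<forall>z\<in>snd c ` fst c. \<forall>u v w. curvature M g c z u v w = 0)"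


section \<open>Parallel transport and the holonomy group\<close>

definition unit_partition :: "nat \<Rightarrow> (nat \<Rightarrow> real) \<Rightarrow> bool" where
  "unit_partition N \<tau> \<longleftrightarrow> \<tau> 0 = 0 \<and> \<tau> N = 1 \<and> (\<forall>i<N. \<tau> i < \<tau> (Suc i))"

definition C1_curve_on ::
  "('a, 'e::euclidean_space) manifold \<Rightarrow> (real \<Rightarrow> 'a) \<Rightarrow> real \<Rightarrow> real \<Rightarrow> bool" where
  "C1_curve_on M \<gamma> a b \<longleftrightarrow>
     continuous_map (top_of_set {a..b}) (top_space M) \<gamma> \<and>
     (\<forall>c\<in>atlas M. \<exists>D.
        (\<forall>t\<in>{a..b}. \<gamma> t \<in> fst c \<longrightarrow>
            ((snd c \<circ> \<gamma>) has_vector_derivative D t) (at t within {a..b})) \<and>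
        continuous_on {t \<in> {a..b}. \<gamma> t \<in> fst c} D)"

definition piecewise_C1_curve ::
  "('a, 'e::euclidean_space) manifold \<Rightarrow> (real \<Rightarrow> 'a) \<Rightarrow> bool" where
  "piecewise_C1_curve M \<gamma> \<longleftrightarrow>
     (\<exists>N \<tau>. unit_partition N \<tau> \<and> (\<forall>i<N. C1_curve_on M \<gamma> (\<tau> i) (\<tau> (Suc i))))"

text \<open>In each chart, \<open>V' = - \<Gamma>(\<gamma>', V)\<close>.\<close>

definition parallel_on ::
  "('a, 'e::euclidean_space) manifold \<Rightarrow> ('a, 'e) metric_tensor \<Rightarrow> (real \<Rightarrow> 'a) \<Rightarrow>
   (real \<Rightarrow> ('a, 'e) tvec) \<Rightarrow> real \<Rightarrow> real \<Rightarrow> bool" where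
  "parallel_on M g \<gamma> V a b \<longleftrightarrow>
     (\<forall>t\<in>{a..b}. V t \<in> tangent_space M (\<gamma> t) \<and>
        (\<forall>c\<in>charts_at M (\<gamma> t).
           ((\<lambda>s. V s c) has_vector_derivative
              - christoffel M g c (snd c (\<gamma> t))
                  (vector_derivative (snd c \<circ> \<gamma>) (at t within {a..b})) (V t c))
           (at t within {a..b})))"

definition parallel_field ::
  "('a, 'e::euclidean_space) manifold \<Rightarrow> ('a, 'e) metric_tensor \<Rightarrow> (real \<Rightarrow> 'a) \<Rightarrow>
   (real \<Rightarrow> ('a, 'e) tvec) \<Rightarrow> bool" where
  "parallel_field M g \<gamma> V \<longleftrightarrow>
     (\<exists>N \<tau>. unit_partition N \<tau> \<and>
        (\<forall>i<N. C1_curve_on M \<gamma> (\<tau> i) (\<tau> (Suc i)) \<and> parallel_on M g \<gamma> V (\<tau> i) (\<tau> (Suc i))))"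

definition parallel_transport ::
  "('a, 'e::euclidean_space) manifold \<Rightarrow> ('a, 'e) metric_tensor \<Rightarrow> (real \<Rightarrow> 'a) \<Rightarrow>
   ('a, 'e) tvec \<Rightarrow> ('a, 'e) tvec" where
  "parallel_transport M g \<gamma> v = (THE w. \<exists>V. parallel_field M g \<gamma> V \<and> V 0 = v \<and> V 1 = w)"

definition holonomy_group ::
  "('a, 'e::euclidean_space) manifold \<Rightarrow> ('a, 'e) metric_tensor \<Rightarrow> 'a \<Rightarrow>
   (('a, 'e) tvec \<Rightarrow> ('a, 'e) tvec) monoid" where
  "holonomy_group M g x =
     \<lparr>carrier = {restrict (parallel_transport M g \<gamma>) (tangent_space M x) | \<gamma>.
                   piecewise_C1_curve M \<gamma> \<and> \<gamma> 0 = x \<and> \<gamma> 1 = x},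
      monoid.mult = compose (tangent_space M x),
      one = (\<lambda>v\<in>tangent_space M x. v)\<rparr>"


section \<open>Lie groups, lattices and flat solvmanifolds\<close>

definition lie_group :: "'a monoid \<Rightarrow> ('a, 'e::euclidean_space) manifold \<Rightarrow> bool" where
  "lie_group G M \<longleftrightarrow>
     group G \<and> smooth_manifold M \<and> carrier G = topspace (top_space M) \<and>
     smooth_map (product_manifold M M) M (\<lambda>(x, y). x \<otimes>\<^bsub>G\<^esub> y) \<and>
     smooth_map M M (\<lambda>x. inv\<^bsub>G\<^esub> x)"

text \<open>The library's \<^const>\<open>simply_connected\<close> for abstract topologies: any two loops are freely
  homotopic through loops (in particular the space is path connected).\<close>

definition simply_connected_space :: "'a topology \<Rightarrow> bool" where
  "simply_connected_space X \<longleftrightarrow>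
     (\<forall>p q. pathin X p \<and> p 0 = p 1 \<and> pathin X q \<and> q 0 = q 1 \<longrightarrow>
        homotopic_with (\<lambda>r. r 0 = r 1) (top_of_set {0..1::real}) X p q)"

text \<open>The quotient topology on the space of right cosets \<open>\<Gamma> g\<close>, which
  HOL-Algebra writes \<open>\<Gamma> #> g\<close>.\<close>

definition coset_topology :: "'a monoid \<Rightarrow> 'a topology \<Rightarrow> 'a set \<Rightarrow> 'a set topology" where
  "coset_topology G X \<Gamma> =
     topology (\<lambda>\<V>. \<V> \<subseteq> rcosets\<^bsub>G\<^esub> \<Gamma> \<and> openin X {x \<in> topspace X. \<Gamma> #>\<^bsub>G\<^esub> x \<in> \<V>})"

lemma openin_coset_topology:
  "openin (coset_topology G X \<Gamma>) \<V> \<longleftrightarrow>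
     \<V> \<subseteq> rcosets\<^bsub>G\<^esub> \<Gamma> \<and> openin X {x \<in> topspace X. \<Gamma> #>\<^bsub>G\<^esub> x \<in> \<V>}"
proof -
  let ?P = "\<lambda>\<V>. \<V> \<subseteq> rcosets\<^bsub>G\<^esub> \<Gamma> \<and> openin X {x \<in> topspace X. \<Gamma> #>\<^bsub>G\<^esub> x \<in> \<V>}"
  have "istopology ?P"
    unfolding istopology_def
  proof (intro conjI allI impI)
    fix S T assume "?P S" "?P T"
    moreover have "{x \<in> topspace X. \<Gamma> #>\<^bsub>G\<^esub> x \<in> S \<inter> T} =
        {x \<in> topspace X. \<Gamma> #>\<^bsub>G\<^esub> x \<in> S} \<inter> {x \<in> topspace X. \<Gamma> #>\<^bsub>G\<^esub> x \<in> T}" by auto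
    ultimately show "S \<inter> T \<subseteq> rcosets\<^bsub>G\<^esub> \<Gamma>" "openin X {x \<in> topspace X. \<Gamma> #>\<^bsub>G\<^esub> x \<in> S \<inter> T}"
      by auto
  next
    fix K assume K: "\<forall>S\<in>K. ?P S"
    have "{x \<in> topspace X. \<Gamma> #>\<^bsub>G\<^esub> x \<in> \<Union> K} = (\<Union>S\<in>K. {x \<in> topspace X. \<Gamma> #>\<^bsub>G\<^esub> x \<in> S})"
      by auto
    with K show "\<Union> K \<subseteq> rcosets\<^bsub>G\<^esub> \<Gamma>" "openin X {x \<in> topspace X. \<Gamma> #>\<^bsub>G\<^esub> x \<in> \<Union> K}"
      by auto
  qed
  then show ?thesis
    by (simp add: coset_topology_def topology_inverse')
qed

definition lattice_in :: "'a set \<Rightarrow> 'a monoid \<Rightarrow> ('a, 'e) manifold \<Rightarrow> bool" where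
  "lattice_in \<Gamma> G M \<longleftrightarrow>
     subgroup \<Gamma> G \<and>
     subtopology (top_space M) \<Gamma> = discrete_topology \<Gamma> \<and>
     compact_space (coset_topology G (top_space M) \<Gamma>)"

text \<open>The smooth structure on \<open>\<Gamma>\<backslash>G\<close> that makes the projection a local diffeomorphism: its charts are
  the charts of \<open>G\<close>, restricted to open sets on which the projection is injective, and composed with
  the corresponding local inverse of the projection.\<close>

definition coset_manifold ::
  "'a monoid \<Rightarrow> ('a, 'e) manifold \<Rightarrow> 'a set \<Rightarrow> ('a set, 'e) manifold" where
  "coset_manifold G M \<Gamma> =
     \<lparr>top_space = coset_topology G (top_space M) \<Gamma>,
      atlas = {((\<lambda>x. \<Gamma> #>\<^bsub>G\<^esub> x) ` W, snd c \<circ> inv_into W (\<lambda>x. \<Gamma> #>\<^bsub>G\<^esub> x)) | c W.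
                 c \<in> atlas M \<and> openin (top_space M) W \<and> W \<subseteq> fst c \<and>
                 inj_on (\<lambda>x. \<Gamma> #>\<^bsub>G\<^esub> x) W}\<rparr>"

definition left_invariant_metric ::
  "'a monoid \<Rightarrow> ('a, 'e::euclidean_space) manifold \<Rightarrow> ('a, 'e) metric_tensor \<Rightarrow> bool" where
  "left_invariant_metric G M g \<longleftrightarrow>
     (\<forall>a\<in>carrier G. \<forall>x\<in>carrier G. \<forall>v\<in>tangent_space M x. \<forall>w\<in>tangent_space M x.
        g (a \<otimes>\<^bsub>G\<^esub> x) (differential M M (\<lambda>y. a \<otimes>\<^bsub>G\<^esub> y) x v) (differential M M (\<lambda>y. a \<otimes>\<^bsub>G\<^esub> y) x w)
          = g x v w)"

text \<open>\<open>h\<close> is the metric on \<open>\<Gamma>\<backslash>G\<close> induced by \<open>g\<close> if its pullback under the projection is \<open>g\<close>.\<close>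

definition induced_metric ::
  "'a monoid \<Rightarrow> ('a, 'e::euclidean_space) manifold \<Rightarrow> 'a set \<Rightarrow>
   ('a, 'e) metric_tensor \<Rightarrow> ('a set, 'e) metric_tensor \<Rightarrow> bool" where
  "induced_metric G M \<Gamma> g h \<longleftrightarrow>
     (\<forall>x\<in>carrier G. \<forall>v\<in>tangent_space M x. \<forall>w\<in>tangent_space M x.
        h (\<Gamma> #>\<^bsub>G\<^esub> x)
          (differential M (coset_manifold G M \<Gamma>) (\<lambda>y. \<Gamma> #>\<^bsub>G\<^esub> y) x v)
          (differential M (coset_manifold G M \<Gamma>) (\<lambda>y. \<Gamma> #>\<^bsub>G\<^esub> y) x w) = g x v w)"

definition flat_solvmanifold ::
  "('a set, 'e::euclidean_space) manifold \<Rightarrow> ('a set, 'e) metric_tensor \<Rightarrow> bool" where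
  "flat_solvmanifold Q h \<longleftrightarrow>
     (\<exists>(G :: 'a monoid) M \<Gamma> g.
        lie_group G M \<and> simply_connected_space (top_space M) \<and> solvable G \<and>
        lattice_in \<Gamma> G M \<and>
        riemannian_metric M g \<and> left_invariant_metric G M g \<and> flat_metric M g \<and>
        Q = coset_manifold G M \<Gamma> \<and>
        riemannian_metric Q h \<and> induced_metric G M \<Gamma> g h)"

text \<open>Since holonomy groups of a connected manifold at different points are isomorphic, the condition
  is imposed at every point.\<close>

definition has_holonomy_group ::
  "('a, 'e::euclidean_space) manifold \<Rightarrow> ('a, 'e) metric_tensor \<Rightarrow> 'b monoid \<Rightarrow> bool" where
  "has_holonomy_group Q h H \<longleftrightarrow> (\<forall>x\<in>topspace (top_space Q). holonomy_group Q h x \<cong> H)"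

end

theory Submission
  imports Defs
begin

text \<open>
  For a one-parameter group \<open>rot\<close> of isometries of a Euclidean space fixing a linear form \<open>\<tau>\<close>, the
  multiplication \<open>x \<star> y = x + rot (\<tau> x) y\<close> makes the space a solvable Lie group whose left
  translations are Euclidean motions, so the constant metric is left invariant and flat. If an
  additive lattice \<open>L\<close> is invariant under \<open>rot 1\<close> and \<open>\<tau> ` L = \<int>\<close>, then \<open>L\<close> is also a lattice
  of this group. Parallel transport in the quotient is constant along lifts of curves, so
  its holonomy group consists of the maps \<open>rot n\<close> with \<open>n\<close> an integer and is cyclic of the order of
  \<open>rot 1\<close>.

  It remains to realise \<open>\<int>\<^sup>n\<close> with \<open>n = (p - 1) q + 1\<close>, \<open>q = p\<^sup>k\<^sup>-\<^sup>1\<close>, as such an \<open>L\<close>, where \<open>\<tau>\<close> is one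
  of the coordinates and the others are the initial terms of a sequence. The sequences
  \<open>f\<close> of period \<open>N = p q\<close> with \<open>f a + f (a + q) + \<dots> + f (a + (p - 1) q) = 0\<close> are determined by their
  first \<open>(p - 1) q\<close> terms, and the shift preserves integrality and has order \<open>N\<close>. Their Fourier
  transform lives on the frequencies \<open>l\<close> not divisible by \<open>p\<close>, and in particular not on \<open>0\<close> and \<open>N / 2\<close>, so
  rotating the \<open>l\<close>-th component at speed \<open>2 \<pi> l / N\<close> with \<open>\<bar>l\<bar> < N / 2\<close> yields a real one-parameter group
  through the shift. Changing the speed by \<open>\<pi> sgn l\<close> replaces the shift by its negative, which has
  order \<open>2 N\<close> if \<open>N\<close> is odd.
\<close>

section \<open>Smooth functions\<close>

text \<open>On an open set the derivative at a point depends only on values nearby, so the induction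
  passes from \<open>f\<close> and \<open>g\<close> to their directional derivatives.\<close>

lemma Ck_on_cong:
  assumes "open S" "\<And>x. x \<in> S \<Longrightarrow> f x = g x" "Ck_on n S f"
  shows "Ck_on n S g"
  using assms(2,3)
proof (induction n arbitrary: f g)
  case 0
  then show ?case by (simp cong: continuous_on_cong)
next
  case (Suc n)
  have d: "g differentiable (at x)" "frechet_derivative f (at x) = frechet_derivative g (at x)"
    if "x \<in> S" for x
  proof -
    have f: "f differentiable (at x)" using Suc.prems(2) that by simp
    then have "(f has_derivative frechet_derivative f (at x)) (at x)"
      by (simp add: frechet_derivative_works)
    then have "(g has_derivative frechet_derivative f (at x)) (at x)"
      using has_derivative_transform_within_open assms(1) that Suc.prems(1) by blast
    then show "g differentiable (at x)" "frechet_derivative f (at x) = frechet_derivative g (at x)"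
      by (auto simp: differentiable_def intro: frechet_derivative_at)
  qed
  have "Ck_on n S (\<lambda>x. frechet_derivative g (at x) v)" for v
    using Suc.IH[of "\<lambda>x. frechet_derivative f (at x) v"] d Suc.prems(2) by simp
  with d show ?case by simp
qed

text \<open>Uniqueness of derivatives allows an explicit formula \<open>D\<close> in place of
  \<open>frechet_derivative\<close>.\<close>

lemma Ck_on_SucI:
  assumes "open S" "\<And>x. x \<in> S \<Longrightarrow> (f has_derivative D x) (at x)" "\<And>v. Ck_on n S (\<lambda>x. D x v)"
  shows "Ck_on (Suc n) S f"
proof -
  have "D x = frechet_derivative f (at x)" if "x \<in> S" for x
    using frechet_derivative_at[OF assms(2)[OF that]] .
  then have "Ck_on n S (\<lambda>x. frechet_derivative f (at x) v)" for v
    using Ck_on_cong[OF assms(1) _ assms(3)[of v]] by simp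
  then show ?thesis using assms(2) by (auto simp: differentiable_def)
qed

lemma Ck_on_add:
  assumes "open S" "Ck_on n S f" "Ck_on n S g"
  shows "Ck_on n S (\<lambda>x. f x + g x)"
  using assms(2,3)
proof (induction n arbitrary: f g)
  case 0
  then show ?case by (simp add: continuous_on_add)
next
  case (Suc n)
  show ?case
  proof (rule Ck_on_SucI[OF assms(1)])
    fix x assume "x \<in> S"
    then show "((\<lambda>x. f x + g x) has_derivative
        (\<lambda>v. frechet_derivative f (at x) v + frechet_derivative g (at x) v)) (at x)"
      using Suc.prems by (intro has_derivative_add) (auto simp: frechet_derivative_works[symmetric])
  next
    show "Ck_on n S (\<lambda>x. frechet_derivative f (at x) v + frechet_derivative g (at x) v)" for v
      using Suc by simp
  qed
qed

text \<open>Up to sums, this class of functions is closed under directional derivatives, so a plain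
  induction gives all orders. It contains the constants, the linear maps and the summands of the
  group law.\<close>

lemma Ck_on_cos_affine:
  assumes "bounded_linear l" "bounded_linear A"
  shows "Ck_on n UNIV (\<lambda>x. cos (l x + c) *\<^sub>R (A x + b))"
  using assms(2)
proof (induction n arbitrary: A b c)
  case 0
  then show ?case
    using assms(1) by (auto intro!: continuous_intros simp: linear_continuous_on)
next
  case (Suc n)
  show ?case
  proof (rule Ck_on_SucI)
    fix x
    have [derivative_intros]: "(l has_derivative l) (at x)" "(A has_derivative A) (at x)"
      using assms Suc.prems by (simp_all add: bounded_linear_imp_has_derivative)
    \<comment> \<open>Writing \<open>- sin u\<close> as \<open>cos (u + pi/2)\<close> keeps the
      first summand in the class. In the second, \<open>0 + A v\<close> is an affine function of
      \<open>x\<close> with linear part zero.\<close>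
    show "((\<lambda>x. cos (l x + c) *\<^sub>R (A x + b)) has_derivative
       (\<lambda>v. cos (l x + (c + pi/2)) *\<^sub>R (l v *\<^sub>R A x + l v *\<^sub>R b) + cos (l x + c) *\<^sub>R (0 + A v))) (at x)"
      by (rule derivative_eq_intros refl)+
        (simp add: fun_eq_iff cos_add scaleR_add_right algebra_simps sin_add)
  next
    fix v
    have "bounded_linear (\<lambda>x. l v *\<^sub>R A x)"
      using Suc.prems by (simp add: bounded_linear_const_scaleR)
    then show "Ck_on n UNIV (\<lambda>x. cos (l x + (c + pi/2)) *\<^sub>R (l v *\<^sub>R A x + l v *\<^sub>R b)
        + cos (l x + c) *\<^sub>R (0 + A v))"
      by (intro Ck_on_add Suc.IH bounded_linear_zero) simp_all
  qed simp
qed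

lemma smooth_on_cos_linear:
  assumes "bounded_linear l" "bounded_linear A"
  shows "smooth_on UNIV (\<lambda>x. cos (l x + c) *\<^sub>R A x)"
  using Ck_on_cos_affine[OF assms, of _ c 0] by (simp add: smooth_on_def)

lemma smooth_on_const: "smooth_on UNIV (\<lambda>x::'e::euclidean_space. b)"
proof -
  have "Ck_on n UNIV (\<lambda>x::'e. b)" for n
    using Ck_on_cos_affine[OF bounded_linear_zero bounded_linear_zero, of n 0 b] by simp
  then show ?thesis by (simp add: smooth_on_def)
qed

lemma smooth_on_linear:
  assumes "bounded_linear A"
  shows "smooth_on UNIV A"
  using smooth_on_cos_linear[OF bounded_linear_zero assms, of 0] by simp

lemma smooth_on_add:
  "open S \<Longrightarrow> smooth_on S f \<Longrightarrow> smooth_on S g \<Longrightarrow> smooth_on S (\<lambda>x. f x + g x)"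
  by (simp add: smooth_on_def Ck_on_add)

lemma smooth_on_sum:
  assumes "\<And>i. i \<in> I \<Longrightarrow> smooth_on UNIV (f i)"
  shows "smooth_on UNIV (\<lambda>x. \<Sum>i\<in>I. f i x)"
proof (cases "finite I")
  case True
  then show ?thesis using assms
    by induction (simp_all add: smooth_on_const smooth_on_add)
qed (simp add: smooth_on_const)

lemma Ck_on_subset: "Ck_on n T f \<Longrightarrow> S \<subseteq> T \<Longrightarrow> Ck_on n S f"
  by (induction n arbitrary: f) (auto intro: continuous_on_subset)

lemma smooth_on_subset: "smooth_on T f \<Longrightarrow> S \<subseteq> T \<Longrightarrow> smooth_on S f"
  by (auto simp: smooth_on_def intro: Ck_on_subset)

lemma smooth_on_cong:
  "open S \<Longrightarrow> (\<And>x. x \<in> S \<Longrightarrow> f x = g x) \<Longrightarrow> smooth_on S f \<Longrightarrow> smooth_on S g"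
  by (meson Ck_on_cong smooth_on_def)

lemma smooth_on_compose_linear:
  assumes "smooth_on UNIV f" "bounded_linear A"
  shows "smooth_on UNIV (\<lambda>x. f (A x))"
proof -
  have "Ck_on n UNIV (\<lambda>x. f (A x))" if "Ck_on n UNIV f" for n
    using that
  proof (induction n arbitrary: f)
    case 0
    then show ?case
      using assms(2) by (auto intro: continuous_on_compose2 linear_continuous_on)
  next
    case (Suc n)
    show ?case
    proof (rule Ck_on_SucI)
      fix x
      have "(f has_derivative frechet_derivative f (at (A x))) (at (A x))"
        using Suc.prems by (simp add: frechet_derivative_works[symmetric])
      then show "((\<lambda>x. f (A x)) has_derivative (\<lambda>v. frechet_derivative f (at (A x)) (A v))) (at x)"
        using diff_chain_at[OF bounded_linear_imp_has_derivative[OF assms(2)]] by (simp add: o_def)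
    next
      show "Ck_on n UNIV (\<lambda>x. frechet_derivative f (at (A x)) (A v))" for v
        using Suc.IH[of "\<lambda>x. frechet_derivative f (at x) (A v)"] Suc.prems by simp
    qed simp
  qed
  then show ?thesis using assms(1) by (simp add: smooth_on_def)
qed

text \<open>Every coordinate expression met below is locally a constant plus a linear map, so this
  rule computes all their derivatives.\<close>

lemma frechet_derivative_locally_affine:
  assumes "open U" "x \<in> U" "bounded_linear A" "\<And>y. y \<in> U \<Longrightarrow> f y = b + A y"
  shows "frechet_derivative f (at x) = A"
proof -
  have "((\<lambda>y. b + A y) has_derivative A) (at x)"
    using has_derivative_add[OF has_derivative_const bounded_linear_imp_has_derivative[OF assms(3)]]
    by simp
  then have "(f has_derivative A) (at x)"
    by (rule has_derivative_transform_within_open[OF _ assms(1,2)]) (simp add: assms(4))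
  then show ?thesis by (rule frechet_derivative_at[symmetric])
qed

text \<open>The straight-line homotopy between two loops runs through loops.\<close>

lemma simply_connected_space_euclidean:
  "simply_connected_space (euclidean :: 'a::real_normed_vector topology)"
  unfolding simply_connected_space_def
proof (intro allI impI)
  fix p q :: "real \<Rightarrow> 'a"
  assume *: "pathin euclidean p \<and> p 0 = p 1 \<and> pathin euclidean q \<and> q 0 = q 1"
  then have c: "continuous_on {0..1} p" "continuous_on {0..1} q"
    by (simp_all add: pathin_def continuous_map_iff_continuous)
  let ?h = "\<lambda>z. (1 - fst z) *\<^sub>R p (snd z) + fst z *\<^sub>R q (snd z)"
  have "continuous_on ({0..1} \<times> {0..1}) ?h"
    by (intro continuous_intros continuous_on_compose2[OF c(1)] continuous_on_compose2[OF c(2)]) auto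
  then have "continuous_map (prod_topology (top_of_set {0..1}) (top_of_set {0..1})) euclidean ?h"
    by (simp flip: subtopology_Times euclidean_product_topology
        add: continuous_map_iff_continuous)
  then show "homotopic_with (\<lambda>r. r 0 = r 1) (top_of_set {0..1}) euclidean p q"
    unfolding homotopic_with_def using * by (intro exI[of _ ?h]) auto
qed

section \<open>Lattices invariant under a screw motion\<close>

text \<open>The inner product \<open>B\<close> becomes the constant metric. The expression
  \<open>h + rot (\<tau> h) x\<close> in \<open>L_cocompact\<close> is the group product of
  \<open>h\<close> and \<open>x\<close>, written out because the group is defined only
  afterwards.\<close>

locale screw_lattice =
  fixes rot :: "real \<Rightarrow> 'e::euclidean_space \<Rightarrow> 'e" and \<tau> :: "'e \<Rightarrow> real"
    and B :: "'e \<Rightarrow> 'e \<Rightarrow> real" and L :: "'e set"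
  assumes linear_rot: "linear (rot t)"
    and rot_0: "rot 0 x = x"
    and rot_rot: "rot s (rot t x) = rot (s + t) x"
    and linear_\<tau>: "linear \<tau>"
    and \<tau>_rot: "\<tau> (rot t x) = \<tau> x"
    and smooth_rot: "smooth_on UNIV (\<lambda>z. rot (\<tau> (fst z)) (snd z))"
    and bilinear_B: "bilinear B"
    and B_sym: "B x y = B y x"
    and B_pos: "x \<noteq> 0 \<Longrightarrow> 0 < B x x"
    and B_rot: "B (rot t x) (rot t y) = B x y"
    and L_add: "x \<in> L \<Longrightarrow> y \<in> L \<Longrightarrow> x + y \<in> L"
    and L_minus: "x \<in> L \<Longrightarrow> - x \<in> L"
    and L_rot: "x \<in> L \<Longrightarrow> r \<in> \<int> \<Longrightarrow> rot r x \<in> L"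
    and \<tau>_L: "\<tau> ` L = \<int>"
    and L_discrete: "\<exists>e>0. \<forall>x\<in>L. norm x < e \<longrightarrow> x = 0"
    and L_cocompact: "\<exists>K. compact K \<and> (\<forall>x. \<exists>h\<in>L. h + rot (\<tau> h) x \<in> K)"
begin

lemmas rot_simps [simp] = linear_add[OF linear_rot] linear_0[OF linear_rot] linear_neg[OF linear_rot]
  linear_diff[OF linear_rot] linear_cmul[OF linear_rot] rot_0 rot_rot
lemmas \<tau>_simps [simp] = linear_add[OF linear_\<tau>] linear_0[OF linear_\<tau>] linear_neg[OF linear_\<tau>]
  linear_diff[OF linear_\<tau>] linear_cmul[OF linear_\<tau>] \<tau>_rot

lemma bounded_linear_rot: "bounded_linear (rot t)"
  using linear_rot linear_conv_bounded_linear by blast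

lemma L_0: "0 \<in> L"
  by (metis L_add L_minus \<tau>_L Ints_0 add.right_inverse imageE)

section \<open>The solvable Lie group\<close>

definition gmul :: "'e \<Rightarrow> 'e \<Rightarrow> 'e" (infixl "\<star>" 70) where
  "x \<star> y = x + rot (\<tau> x) y"

definition ginv :: "'e \<Rightarrow> 'e" where
  "ginv x = - rot (- \<tau> x) x"

lemma gmul_simps [simp]:
  "0 \<star> x = x" "x \<star> 0 = x" "ginv x \<star> x = 0" "x \<star> ginv x = 0" "\<tau> (x \<star> y) = \<tau> x + \<tau> y"
  "\<tau> (ginv x) = - \<tau> x"
  by (simp_all add: gmul_def ginv_def)

lemma gmul_assoc: "x \<star> y \<star> z = x \<star> (y \<star> z)"
  by (simp add: gmul_def add.assoc)

lemma gmul_ginv_cancel [simp]: "x \<star> y \<star> ginv y = x" "x \<star> ginv y \<star> y = x"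
  "ginv x \<star> (x \<star> y) = y" "x \<star> (ginv x \<star> y) = y"
  by (simp_all add: gmul_assoc) (simp_all add: gmul_assoc[symmetric])

definition G :: "'e monoid" where
  "G = \<lparr>carrier = UNIV, monoid.mult = (\<star>), one = 0\<rparr>"

text \<open>With one global chart, a tangent vector amounts to its coordinate vector in
  \<open>(UNIV, id)\<close>.\<close>

definition M :: "('e, 'e) manifold" where
  "M = \<lparr>top_space = euclidean, atlas = {(UNIV, id)}\<rparr>"

lemma G_simps [simp]: "carrier G = UNIV" "x \<otimes>\<^bsub>G\<^esub> y = x \<star> y" "\<one>\<^bsub>G\<^esub> = 0"
  by (simp_all add: G_def)

lemma M_simps [simp]: "top_space M = euclidean" "atlas M = {(UNIV, id)}"
  by (simp_all add: M_def)

lemma group_G: "group G"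
proof (rule groupI)
  show "\<exists>y\<in>carrier G. y \<otimes>\<^bsub>G\<^esub> x = \<one>\<^bsub>G\<^esub>" for x
    by (rule bexI[of _ "ginv x"]) simp_all
qed (simp_all add: gmul_assoc)

lemma inv_G [simp]: "inv\<^bsub>G\<^esub> x = ginv x"
  by (rule group.inv_equality[OF group_G]) simp_all

lemma smooth_gmul: "smooth_on UNIV (\<lambda>z. fst z \<star> snd z)"
  unfolding gmul_def
  by (intro smooth_on_add smooth_rot smooth_on_linear bounded_linear_fst open_UNIV)

text \<open>The inverse of \<open>x\<close> is \<open>rot (\<tau> y) y\<close> at
  \<open>y = - x\<close>, so it is the map of \<open>smooth_rot\<close> composed with a linear
  map.\<close>

lemma smooth_ginv: "smooth_on UNIV ginv"
proof -
  have "bounded_linear (\<lambda>x::'e. (- x, - x))"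
    by (intro bounded_linear_Pair bounded_linear_minus bounded_linear_ident)
  from smooth_on_compose_linear[OF smooth_rot this]
  show ?thesis by (simp add: ginv_def[abs_def])
qed

lemma continuous_gmul: "continuous_on UNIV (\<lambda>z. fst z \<star> snd z)"
  using smooth_gmul by (simp add: smooth_on_def) (metis Ck_on.simps(1))

lemma continuous_on_gmul [continuous_intros]:
  "continuous_on S f \<Longrightarrow> continuous_on S g \<Longrightarrow> continuous_on S (\<lambda>x. f x \<star> g x)"
  using continuous_on_compose2[OF continuous_gmul, of S "\<lambda>x. (f x, g x)"]
  by (simp add: continuous_on_Pair)

lemma continuous_on_ginv [continuous_intros]:
  "continuous_on S f \<Longrightarrow> continuous_on S (\<lambda>x. ginv (f x))"
  using smooth_ginv continuous_on_compose2[of UNIV ginv S f]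
  by (simp add: smooth_on_def) (metis Ck_on.simps(1))

lemma charts_at_M [simp]: "charts_at M x = {(UNIV, id)}"
  by (auto simp: charts_at_def)

lemma chart_inv_id [simp]: "chart_inv (UNIV, id) = id"
  by (simp add: chart_inv_def)

lemma smooth_manifold_M: "smooth_manifold M"
proof -
  have "second_countable (euclidean :: 'e topology)"
    unfolding second_countable_def
    by (meson ex_countable_basis open_openin topological_basisE topological_basis_open)
  moreover have "chart_transition (UNIV, id) (UNIV, id) = (\<lambda>x::'e. x)"
    by (simp add: coord_rep_def fun_eq_iff)
  ultimately show ?thesis
    by (simp add: smooth_manifold_def smooth_on_linear bounded_linear_ident)
qed

lemma lie_group_G: "lie_group G M"
  unfolding lie_group_def
proof (intro conjI group_G smooth_manifold_M)
  have inv: "chart_inv (UNIV, id) = (id :: 'e \<times> 'e \<Rightarrow> 'e \<times> 'e)"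
    by (simp add: chart_inv_def)
  show "smooth_map (product_manifold M M) M (\<lambda>(x, y). x \<otimes>\<^bsub>G\<^esub> y)"
    unfolding smooth_map_def product_manifold_def
    using continuous_gmul smooth_gmul
    by (simp add: coord_rep_def inv map_prod.id case_prod_unfold o_def image_id)
  show "smooth_map M M (\<lambda>x. inv\<^bsub>G\<^esub> x)"
    unfolding smooth_map_def using smooth_ginv continuous_on_ginv[OF continuous_on_id, of UNIV]
    by (simp add: coord_rep_def o_def)
qed simp

text \<open>The form \<tau> is a homomorphism to the reals, so commutators lie in its kernel
  \<open>?K\<close>. There \<open>rot (\<tau> x)\<close> is the identity and the product is
  addition, so the second derived group is trivial.\<close>

lemma solvable_G: "solvable G"
proof -
  interpret group G by (rule group_G)
  let ?K = "{x. \<tau> x = 0}"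
  have K: "subgroup ?K G"
    by unfold_locales auto
  have "derived_set G UNIV \<subseteq> ?K" by auto
  then have 1: "derived G UNIV \<subseteq> ?K"
    unfolding derived_def using generate_subgroup_incl[OF _ K] by blast
  have "derived_set G ?K \<subseteq> {0}"
    by (auto simp: gmul_def ginv_def)
  then have "derived G ?K \<subseteq> {0}"
    unfolding derived_def using generate_subgroup_incl[OF _ triv_subgroup] by simp
  then have "derived G (derived G UNIV) \<subseteq> {0}"
    using mono_derived[OF 1] by blast
  moreover have "subgroup (derived G (derived G UNIV)) G"
    by (intro derived_is_subgroup) simp
  then have "0 \<in> derived G (derived G UNIV)"
    using subgroup.one_closed by fastforce
  ultimately have "(derived G ^^ 2) (carrier G) = {\<one>\<^bsub>G\<^esub>}"
    by (auto simp: numeral_2_eq_2)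
  then show ?thesis using solvable_iff_trivial_derived_seq by blast
qed

lemma \<tau>_L_Ints: "x \<in> L \<Longrightarrow> \<tau> x \<in> \<int>"
  using \<tau>_L by blast

lemma L_gmul: "x \<in> L \<Longrightarrow> y \<in> L \<Longrightarrow> x \<star> y \<in> L"
  by (simp add: gmul_def L_add L_rot \<tau>_L_Ints)

lemma L_ginv: "x \<in> L \<Longrightarrow> ginv x \<in> L"
  by (simp add: ginv_def L_minus L_rot \<tau>_L_Ints)

lemma subgroup_L: "subgroup L G"
  by unfold_locales (auto simp: L_0 L_gmul L_ginv)

section \<open>The quotient by the lattice\<close>

definition proj :: "'e \<Rightarrow> 'e set" where
  "proj x = L #>\<^bsub>G\<^esub> x"

lemma proj_eq: "proj x = (\<lambda>h. h \<star> x) ` L"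
  by (auto simp: proj_def r_coset_def)

lemma proj_eq_iff: "proj x = proj y \<longleftrightarrow> (\<exists>h\<in>L. y = h \<star> x)"
proof
  assume "proj x = proj y"
  moreover have "y \<in> proj y" unfolding proj_eq using L_0 by (force intro: image_eqI[of _ _ 0])
  ultimately show "\<exists>h\<in>L. y = h \<star> x" by (auto simp: proj_eq)
next
  assume "\<exists>h\<in>L. y = h \<star> x"
  then obtain h where h: "h \<in> L" "y = h \<star> x" by blast
  have "k \<star> x \<in> proj y" if "k \<in> L" for k
    unfolding proj_eq h(2) using that h(1)
    by (intro image_eqI[of _ _ "k \<star> ginv h"]) (simp_all add: gmul_assoc L_gmul L_ginv)
  moreover have "k \<star> y \<in> proj x" if "k \<in> L" for k
    unfolding proj_eq h(2) using that h(1)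
    by (intro image_eqI[of _ _ "k \<star> h"]) (simp_all add: gmul_assoc L_gmul)
  ultimately show "proj x = proj y" unfolding proj_eq by blast
qed

lemma proj_gmul: "h \<in> L \<Longrightarrow> proj (h \<star> x) = proj x"
  using proj_eq_iff by metis

definition Q :: "('e set, 'e) manifold" where
  "Q = coset_manifold G M L"

lemma openin_Q: "openin (top_space Q) V \<longleftrightarrow> V \<subseteq> range proj \<and> open {x. proj x \<in> V}"
  by (auto simp: Q_def coset_manifold_def openin_coset_topology RCOSETS_def proj_def)

lemma topspace_Q: "topspace (top_space Q) = range proj"
proof
  show "topspace (top_space Q) \<subseteq> range proj"
    using openin_Q[of "topspace (top_space Q)"] by simp
  have "openin (top_space Q) (range proj)" unfolding openin_Q by simp
  then show "range proj \<subseteq> topspace (top_space Q)" by (rule openin_subset)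
qed

lemma open_translate: "open W \<Longrightarrow> open {y. h \<star> y \<in> W}"
  using open_vimage[of W "\<lambda>y. h \<star> y"]
  by (simp add: continuous_on_gmul vimage_def)

text \<open>The saturation of \<open>W\<close> is a union of translates of \<open>W\<close> by
  lattice elements.\<close>

lemma openin_proj_image:
  assumes "open W" shows "openin (top_space Q) (proj ` W)"
proof -
  have "{x. proj x \<in> proj ` W} = (\<Union>h\<in>L. {x. h \<star> x \<in> W})"
    by (auto simp: proj_eq_iff image_iff)
  also have "open \<dots>" by (intro open_UN ballI open_translate assms)
  finally show ?thesis unfolding openin_Q by auto
qed

lemma continuous_map_proj: "continuous_map euclidean (top_space Q) proj"
  unfolding continuous_map_def by (auto simp: topspace_Q openin_Q)

text \<open>Points with the same projection satisfy \<open>z = h \<star> y\<close> with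
  \<open>h\<close> in \<open>L\<close>. The quotient \<open>z \<star> ginv y\<close> is continuous
  and \<open>0\<close> on the diagonal, so near \<open>(x, x)\<close> it is too short to be a
  nonzero lattice element.\<close>

lemma ex_inj_neighbourhood: "\<exists>W. open W \<and> x \<in> W \<and> inj_on proj W"
proof -
  obtain e where e: "e > 0" "\<And>h. h \<in> L \<Longrightarrow> norm h < e \<Longrightarrow> h = 0"
    using L_discrete by blast
  let ?f = "\<lambda>z. snd z \<star> ginv (fst z)"
  have "open (?f -` ball 0 e)"
    by (intro open_vimage open_ball continuous_intros)
  moreover have "(x, x) \<in> ?f -` ball 0 e" using e by simp
  ultimately obtain U V where UV: "open U" "open V" "x \<in> U" "x \<in> V" "U \<times> V \<subseteq> ?f -` ball 0 e"
    by (rule open_prod_elim) auto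
  have "inj_on proj (U \<inter> V)"
  proof (rule inj_onI)
    fix y z assume yz: "y \<in> U \<inter> V" "z \<in> U \<inter> V" "proj y = proj z"
    then obtain h where h: "h \<in> L" "z = h \<star> y" by (auto simp: proj_eq_iff)
    have "?f (y, z) \<in> ball 0 e" using UV(5) yz by blast
    then have "h = 0" using e(2) h by simp
    with h show "y = z" by simp
  qed
  with UV show ?thesis by (intro exI[of _ "U \<inter> V"]) auto
qed

lemma lattice_L: "lattice_in L G M"
  unfolding lattice_in_def
proof (intro conjI subgroup_L)
  obtain e where e: "e > 0" "\<And>h. h \<in> L \<Longrightarrow> norm h < e \<Longrightarrow> h = 0"
    using L_discrete by blast
  have "openin (top_of_set L) {x}" if "x \<in> L" for x
  proof -
    \<comment> \<open>Discreteness concerns only the topology, so additive differences serve here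
      instead of group quotients.\<close>
    have "y = x" if "y \<in> L" "y \<in> ball x e" for y
      using e(2)[of "y + - x"] L_add[OF \<open>y \<in> L\<close> L_minus[OF \<open>x \<in> L\<close>]] that(2)
      by (simp add: dist_norm norm_minus_commute)
    then have "{x} = L \<inter> ball x e" using that e(1) by auto
    then show ?thesis by (metis open_ball openin_open_Int)
  qed
  then have "subtopology euclidean L = discrete_topology L"
    by (intro discrete_topology_unique[THEN iffD2, symmetric]) simp
  then show "subtopology (top_space M) L = discrete_topology L"
    by simp
  obtain K where K: "compact K" "\<And>x. \<exists>h\<in>L. h \<star> x \<in> K"
    using L_cocompact by (auto simp: gmul_def)
  have "proj x \<in> proj ` K" for x
    using K(2)[of x] proj_gmul by (metis imageI)
  then have "range proj = proj ` K" by blast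
  moreover have "compactin (top_space Q) (proj ` K)"
    using K(1) by (intro image_compactin[OF _ continuous_map_proj]) simp
  ultimately show "compact_space (coset_topology G (top_space M) L)"
    using topspace_Q by (simp add: compact_space_def Q_def coset_manifold_def)
qed

section \<open>Charts and tangent vectors of the quotient\<close>

lemma atlas_Q: "atlas Q = {(proj ` W, inv_into W proj) | W. open W \<and> inj_on proj W}"
  unfolding Q_def coset_manifold_def by (auto simp: proj_def[abs_def])

abbreviation cdom :: "('e set, 'e) chart \<Rightarrow> 'e set" where
  "cdom c \<equiv> snd c ` fst c"

text \<open>A chart of the quotient is a local section of \<open>proj\<close>: its coordinate domain
  is the set \<open>W\<close> itself, and its inverse is \<open>proj\<close> restricted to
  \<open>W\<close>.\<close>

lemma atlas_Q_facts:
  assumes "c \<in> atlas Q"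
  shows open_cdom: "open (cdom c)" and fst_chart: "fst c = proj ` cdom c"
    and snd_chart: "w \<in> cdom c \<Longrightarrow> snd c (proj w) = w"
    and chart_inv_Q: "w \<in> cdom c \<Longrightarrow> chart_inv c w = proj w"
proof -
  obtain W where W: "open W" "inj_on proj W" "c = (proj ` W, inv_into W proj)"
    using assms by (auto simp: atlas_Q)
  have *: "inv_into W proj (proj w) = w" if "w \<in> W" for w
    using W that by simp
  have dom: "cdom c = W"
    unfolding W(3) using * by (simp add: image_image)
  show "open (cdom c)" unfolding dom by (rule W(1))
  show "fst c = proj ` cdom c" unfolding dom by (simp add: W(3))
  show "snd c (proj w) = w" if "w \<in> cdom c" for w
    using that unfolding dom by (simp add: W(3) *)
  show "chart_inv c w = proj w" if "w \<in> cdom c" for w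
    using that unfolding dom chart_inv_def W(3)
    by (intro inv_into_f_eq) (auto simp: * intro!: inj_onI)
qed

text \<open>The coordinate of \<open>proj x\<close> is the representative \<open>h \<star> x\<close>
  of its orbit in \<open>cdom c\<close>. The same \<open>h\<close> serves every \<open>y\<close>
  with \<open>h \<star> y\<close> in this open set.\<close>

lemma chart_lift:
  assumes "c \<in> atlas Q" "proj x \<in> fst c"
  shows "\<exists>U h. open U \<and> x \<in> U \<and> h \<in> L \<and> (\<forall>y\<in>U. proj y \<in> fst c \<and> snd c (proj y) = h \<star> y)"
proof -
  obtain w where "w \<in> cdom c" "proj x = proj w"
    using assms(2) fst_chart[OF assms(1)] by (metis imageE)
  then obtain h where h: "h \<in> L" "h \<star> x \<in> cdom c" by (metis proj_eq_iff)
  have "proj y \<in> fst c \<and> snd c (proj y) = h \<star> y" if "h \<star> y \<in> cdom c" for y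
  proof -
    have "proj y = proj (h \<star> y)" using proj_gmul[OF h(1)] by simp
    moreover have "proj (h \<star> y) \<in> fst c" using fst_chart[OF assms(1)] that by blast
    ultimately show ?thesis using snd_chart[OF assms(1) that] by simp
  qed
  with h open_translate[OF open_cdom[OF assms(1)], of h] show ?thesis
    by (intro exI[of _ "{y. h \<star> y \<in> cdom c}"] exI[of _ h]) simp
qed

text \<open>Near \<open>x\<close> the chart is \<open>y \<mapsto> h + rot (\<tau> h) y\<close>.
  Taking \<tau> of \<open>h \<star> x\<close> recovers \<open>\<tau> h\<close>, so the formula need
  not mention \<open>h\<close>.\<close>

lemma frechet_derivative_chart:
  assumes "c \<in> charts_at Q (proj x)" "\<And>y. y \<in> U \<Longrightarrow> f y = snd c (proj y)" "open U" "x \<in> U"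
  shows "frechet_derivative f (at x) = rot (\<tau> (snd c (proj x)) - \<tau> x)"
proof -
  have "c \<in> atlas Q" "proj x \<in> fst c" using assms(1) by (auto simp: charts_at_def)
  from chart_lift[OF this] obtain V h where V: "open V" "x \<in> V" "h \<in> L"
    "\<forall>y\<in>V. proj y \<in> fst c \<and> snd c (proj y) = h \<star> y" by blast
  have "frechet_derivative f (at x) = rot (\<tau> h)"
  proof (rule frechet_derivative_locally_affine[of "U \<inter> V"])
    show "f y = h + rot (\<tau> h) y" if "y \<in> U \<inter> V" for y
      using that V(4) assms(2) by (simp add: gmul_def)
  qed (use V assms bounded_linear_rot in auto)
  moreover have "snd c (proj x) = h \<star> x" using V(2,4) by blast
  ultimately show ?thesis by simp
qed

lemma frechet_derivative_chart_transition:
  assumes "c \<in> charts_at Q X" "d \<in> charts_at Q X"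
  shows "frechet_derivative (chart_transition c d) (at (snd c X)) = rot (\<tau> (snd d X) - \<tau> (snd c X))"
proof -
  have c: "c \<in> atlas Q" "X \<in> fst c" using assms(1) by (auto simp: charts_at_def)
  then obtain w where w: "w \<in> cdom c" "X = proj w" using fst_chart[OF c(1)] by blast
  have "frechet_derivative (chart_transition c d) (at w) = rot (\<tau> (snd d (proj w)) - \<tau> w)"
  proof (rule frechet_derivative_chart[of d w "cdom c"])
    show "chart_transition c d y = snd d (proj y)" if "y \<in> cdom c" for y
      using chart_inv_Q[OF c(1) that] by (simp add: coord_rep_def)
  qed (use assms(2) w open_cdom c in auto)
  then show ?thesis using w snd_chart[OF c(1) w(1)] by simp
qed

lemma charts_at_Q_nonempty: "charts_at Q (proj x) \<noteq> {}"
proof -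
  obtain W where "open W" "x \<in> W" "inj_on proj W" using ex_inj_neighbourhood by blast
  then have "(proj ` W, inv_into W proj) \<in> charts_at Q (proj x)"
    by (auto simp: charts_at_def atlas_Q)
  then show ?thesis by blast
qed

text \<open>This is the differential of \<open>proj\<close> at \<open>x\<close>, as
  \<open>differential_proj\<close> confirms. It identifies the tangent space at
  \<open>proj x\<close> with the vector space, in a way that depends on the lift
  \<open>x\<close>.\<close>

definition dproj :: "'e \<Rightarrow> 'e \<Rightarrow> ('e set, 'e) tvec" where
  "dproj x u = (\<lambda>d. if d \<in> charts_at Q (proj x) then rot (\<tau> (snd d (proj x)) - \<tau> x) u else 0)"

lemma dproj_chart: "d \<in> charts_at Q (proj x) \<Longrightarrow> dproj x u d = rot (\<tau> (snd d (proj x)) - \<tau> x) u"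
  by (simp add: dproj_def)

lemma dproj_in_tangent_space: "dproj x u \<in> tangent_space Q (proj x)"
  unfolding tangent_space_def by (simp add: frechet_derivative_chart_transition dproj_def)

lemma tangent_space_Q_eqI:
  assumes "v \<in> tangent_space Q X" "w \<in> tangent_space Q X" "c \<in> charts_at Q X" "v c = w c"
  shows "v = w"
proof
  fix d
  show "v d = w d"
  proof (cases "d \<in> charts_at Q X")
    case True
    have "v d = frechet_derivative (chart_transition c d) (at (snd c X)) (v c)"
      using assms(1,3) True unfolding tangent_space_def by blast
    moreover have "w d = frechet_derivative (chart_transition c d) (at (snd c X)) (w c)"
      using assms(2,3) True unfolding tangent_space_def by blast
    ultimately show ?thesis using assms(4) by simp
  next
    case False
    have "v d = 0" "w d = 0" using assms(1,2) False unfolding tangent_space_def by blast+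
    then show ?thesis by simp
  qed
qed

lemma tangent_space_Q: "tangent_space Q (proj x) = range (dproj x)"
proof -
  have "v \<in> range (dproj x)" if "v \<in> tangent_space Q (proj x)" for v
  proof -
    obtain c where c: "c \<in> charts_at Q (proj x)" using charts_at_Q_nonempty by blast
    \<comment> \<open>The preimage undoes the rotation that \<open>dproj\<close> applies in the
      chart \<open>c\<close>.\<close>
    have "v = dproj x (rot (\<tau> x - \<tau> (snd c (proj x))) (v c))"
      by (rule tangent_space_Q_eqI[OF that dproj_in_tangent_space c]) (simp add: dproj_chart c)
    then show ?thesis by blast
  qed
  then show ?thesis using dproj_in_tangent_space by blast
qed

lemma inj_dproj: "inj (dproj x)"
proof (rule injI)
  fix u v assume eq: "dproj x u = dproj x v"
  obtain c where c: "c \<in> charts_at Q (proj x)" using charts_at_Q_nonempty by blast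
  have "rot (\<tau> x - \<tau> (snd c (proj x))) (dproj x u c) = rot (\<tau> x - \<tau> (snd c (proj x))) (dproj x v c)"
    using eq by simp
  then show "u = v" by (simp add: dproj_chart c)
qed

text \<open>Passing to another lift of the same point changes the identification of the tangent
  space by a rotation. This is the source of the holonomy.\<close>

lemma dproj_gmul:
  assumes "h \<in> L" shows "dproj (h \<star> x) u = dproj x (rot (- \<tau> h) u)"
  using assms by (auto simp: dproj_def proj_gmul fun_eq_iff algebra_simps)

lemma dproj_linear: "dproj x (u + v) = (\<lambda>c. dproj x u c + dproj x v c)"
  "dproj x (r *\<^sub>R u) = (\<lambda>c. r *\<^sub>R dproj x u c)"
  by (auto simp: dproj_def)

section \<open>The constant metrics and their flatness\<close>

definition gM :: "('e, 'e) metric_tensor" where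
  "gM x v w = B (v (UNIV, id)) (w (UNIV, id))"

text \<open>The choice of chart is immaterial: coordinates in different charts differ by a rotation,
  which preserves \<open>B\<close>.\<close>

definition hQ :: "('e set, 'e) metric_tensor" where
  "hQ X v w = (let c = SOME c. c \<in> charts_at Q X in B (v c) (w c))"

lemma hQ_dproj: "hQ (proj x) (dproj x u) (dproj x v) = B u v"
proof -
  have "(SOME c. c \<in> charts_at Q (proj x)) \<in> charts_at Q (proj x)"
    using charts_at_Q_nonempty some_in_eq by blast
  then show ?thesis by (simp add: hQ_def Let_def dproj_chart B_rot)
qed

lemma differential_proj: "differential M Q proj x v = dproj x (v (UNIV, id))"
proof
  fix d
  have "frechet_derivative (coord_rep (UNIV, id) d proj) (at x) = rot (\<tau> (snd d (proj x)) - \<tau> x)"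
    if "d \<in> charts_at Q (proj x)"
    using that by (rule frechet_derivative_chart[of d x UNIV]) (simp_all add: coord_rep_def)
  then show "differential M Q proj x v d = dproj x (v (UNIV, id)) d"
    by (simp add: differential_def dproj_def Let_def)
qed

lemma differential_gmul: "differential M M (\<lambda>y. a \<star> y) x v (UNIV, id) = rot (\<tau> a) (v (UNIV, id))"
proof -
  have "frechet_derivative (\<lambda>y. a \<star> y) (at x) = rot (\<tau> a)"
    by (rule frechet_derivative_locally_affine[of UNIV _ _ _ a])
     (auto simp: bounded_linear_rot gmul_def)
  then show ?thesis by (simp add: differential_def coord_rep_def o_def Let_def)
qed

lemmas B_simps [simp] = bilinear_ladd[OF bilinear_B] bilinear_lmul[OF bilinear_B]
  bilinear_radd[OF bilinear_B] bilinear_rmul[OF bilinear_B]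

lemma tangent_space_M: "v \<in> tangent_space M x \<longleftrightarrow> (\<forall>c. c \<noteq> (UNIV, id) \<longrightarrow> v c = 0)"
  using frechet_derivative_locally_affine[of UNIV x "\<lambda>x. x" "\<lambda>x. x" 0]
  by (auto simp: tangent_space_def coord_rep_def o_def bounded_linear_ident)

lemma tvec_of_M: "tvec_of M x (UNIV, id) u (UNIV, id) = u"
  using frechet_derivative_locally_affine[of UNIV x "\<lambda>x. x" "\<lambda>x. x" 0]
  by (auto simp: tvec_of_def coord_rep_def o_def bounded_linear_ident)

lemma metric_coeff_M: "metric_coeff M gM (UNIV, id) z u v = B u v"
  by (simp add: metric_coeff_def gM_def tvec_of_M)

text \<open>The coordinate \<open>z\<close> is itself a lift of the point, so no rotation intervenes
  and the metric coefficients become constant.\<close>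

lemma tvec_of_Q:
  assumes "c \<in> atlas Q" "z \<in> cdom c"
  shows "tvec_of Q (proj z) c u = dproj z u"
proof
  fix d
  have c: "c \<in> charts_at Q (proj z)"
    using assms fst_chart[OF assms(1)] unfolding charts_at_def by blast
  show "tvec_of Q (proj z) c u d = dproj z u d"
    using frechet_derivative_chart_transition[OF c, of d]
    by (simp add: tvec_of_def dproj_def snd_chart[OF assms])
qed

lemma metric_coeff_Q: "c \<in> atlas Q \<Longrightarrow> z \<in> cdom c \<Longrightarrow> metric_coeff Q hQ c z u v = B u v"
  by (simp only: metric_coeff_def chart_inv_Q tvec_of_Q hQ_dproj)

lemma riemannian_metric_M: "riemannian_metric M gM"
  unfolding riemannian_metric_def
proof (intro conjI ballI allI impI)
  fix x v assume "v \<in> tangent_space M x" "v \<noteq> (\<lambda>c. 0)"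
  then have "v (UNIV, id) \<noteq> 0" unfolding tangent_space_M fun_eq_iff by metis
  then show "0 < gM x v v" unfolding gM_def by (rule B_pos)
next
  show "smooth_on (snd c ` fst c) (\<lambda>z. metric_coeff M gM c z u w)" if "c \<in> atlas M" for c u w
    using that by (simp add: metric_coeff_M smooth_on_const)
qed (simp_all add: gM_def B_sym)

lemma riemannian_metric_Q: "riemannian_metric Q hQ"
  unfolding riemannian_metric_def topspace_Q
proof (intro conjI ballI allI impI)
  fix X v w assume "X \<in> range proj" "v \<in> tangent_space Q X" "w \<in> tangent_space Q X"
  then obtain x a b where x: "X = proj x" "v = dproj x a" "w = dproj x b"
    using tangent_space_Q by auto
  show "hQ X v w = hQ X w v" by (simp add: x hQ_dproj B_sym)
  show "hQ X (\<lambda>c. r *\<^sub>R v c) w = r * hQ X v w" for r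
    using hQ_dproj[of x "r *\<^sub>R a" b] by (simp add: x hQ_dproj dproj_linear)
  fix v' assume "v' \<in> tangent_space Q X"
  then obtain a' where a': "v' = dproj x a'" using tangent_space_Q x by auto
  show "hQ X (\<lambda>c. v c + v' c) w = hQ X v w + hQ X v' w"
    using hQ_dproj[of x "a + a'" b] by (simp add: x a' hQ_dproj dproj_linear)
next
  fix X v assume "X \<in> range proj" "v \<in> tangent_space Q X" "v \<noteq> (\<lambda>c. 0)"
  then obtain x a where x: "X = proj x" "v = dproj x a"
    using tangent_space_Q by auto
  then have "a \<noteq> 0" using \<open>v \<noteq> _\<close> by (auto simp: dproj_def)
  then show "0 < hQ X v v" by (simp add: x hQ_dproj B_pos)
next
  fix c u v assume c: "c \<in> atlas Q"
  show "smooth_on (cdom c) (\<lambda>z. metric_coeff Q hQ c z u v)"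
    by (rule smooth_on_cong[OF open_cdom[OF c] _
          smooth_on_subset[OF smooth_on_const[of "B u v"] subset_UNIV]])
      (simp add: c metric_coeff_Q)
qed

text \<open>Constant coefficients make the right-hand side of the Koszul formula vanish. The general
  \<open>N\<close> and \<open>g\<close> cover both the group and the quotient.\<close>

lemma christoffel_0:
  assumes "open S" "z \<in> S" "\<And>y u w. y \<in> S \<Longrightarrow> metric_coeff N g c y u w = B u w"
  shows "christoffel N g c z u v = 0"
proof -
  have "frechet_derivative (\<lambda>y. metric_coeff N g c y a b) (at z) = (\<lambda>x. 0)" for a b
    by (rule frechet_derivative_locally_affine[of S _ _ _ "B a b"]) (use assms in auto)
  \<comment> \<open>Positivity of \<open>B\<close> makes \<open>0\<close> the only solution, as the
    definite description requires.\<close>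
  moreover have "(\<forall>w. B b w = 0) \<longleftrightarrow> b = 0" for b
    using B_pos[of b] bilinear_lzero[OF bilinear_B] by fastforce
  ultimately show ?thesis
    unfolding christoffel_def by (simp add: assms)
qed

lemma christoffel_Q: "c \<in> atlas Q \<Longrightarrow> z \<in> cdom c \<Longrightarrow> christoffel Q hQ c z u v = 0"
  by (rule christoffel_0[of "cdom c"]) (auto simp: metric_coeff_Q open_cdom)

lemma flat_metric_M: "flat_metric M gM"
proof -
  have *: "christoffel M gM (UNIV, id) z u v = 0" for z u v
    by (rule christoffel_0[of UNIV]) (auto simp: metric_coeff_M)
  show ?thesis by (simp add: flat_metric_def curvature_def *)
qed

lemma flat_solvmanifold_Q: "flat_solvmanifold Q hQ"
  unfolding flat_solvmanifold_def
proof (intro exI conjI)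
  show "left_invariant_metric G M gM"
    by (simp add: left_invariant_metric_def gM_def differential_gmul B_rot)
  show "induced_metric G M L gM hQ"
    unfolding induced_metric_def Q_def[symmetric] proj_def[symmetric]
    by (simp add: differential_proj hQ_dproj gM_def)
qed (simp_all add: lie_group_G simply_connected_space_euclidean solvable_G lattice_L
   riemannian_metric_M flat_metric_M Q_def[symmetric] riemannian_metric_Q)

subsection \<open>Path lifting and holonomy\<close>

text \<open>The preimage of \<open>U\<close> is the image of \<open>U \<inter> cdom c\<close> under
  the open map \<open>proj\<close>.\<close>

lemma continuous_map_chart:
  assumes "c \<in> atlas Q"
  shows "continuous_map (subtopology (top_space Q) (fst c)) euclidean (snd c)"
  unfolding continuous_map_def
proof (intro conjI allI impI)
  fix U :: "'e set" assume "openin euclidean U"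
  then have "openin (top_space Q) (proj ` (U \<inter> cdom c))"
    by (intro openin_proj_image open_Int open_cdom[OF assms]) simp
  moreover have "{X \<in> topspace (subtopology (top_space Q) (fst c)). snd c X \<in> U} = proj ` (U \<inter> cdom c)"
  proof (intro Set.set_eqI iffI)
    fix X assume "X \<in> {X \<in> topspace (subtopology (top_space Q) (fst c)). snd c X \<in> U}"
    then have X: "X \<in> fst c" "snd c X \<in> U" by auto
    then obtain w where w: "w \<in> cdom c" "X = proj w" using fst_chart[OF assms] by blast
    then have "w \<in> U" using X(2) snd_chart[OF assms w(1)] by simp
    then show "X \<in> proj ` (U \<inter> cdom c)" using w by blast
  next
    fix X assume "X \<in> proj ` (U \<inter> cdom c)"
    then obtain w where w: "w \<in> U" "w \<in> cdom c" "X = proj w" by blast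
    moreover have "X \<in> fst c" using w fst_chart[OF assms] by blast
    moreover have "snd c X \<in> U" using snd_chart[OF assms w(2)] w(1,3) by simp
    ultimately show "X \<in> {X \<in> topspace (subtopology (top_space Q) (fst c)). snd c X \<in> U}"
      by (simp add: topspace_Q)
  qed
  ultimately show "openin (subtopology (top_space Q) (fst c))
      {X \<in> topspace (subtopology (top_space Q) (fst c)). snd c X \<in> U}"
    unfolding openin_subtopology using fst_chart[OF assms]
    by (intro exI[of _ "proj ` (U \<inter> cdom c)"]) blast
qed simp

lemma proj_snd_chart:
  assumes "c \<in> atlas Q" "X \<in> fst c"
  shows "proj (snd c X) = X"
proof -
  have "X \<in> proj ` cdom c"
    using equalityD1[OF fst_chart[OF assms(1)]] assms(2) by (rule subsetD)
  then obtain w where "w \<in> cdom c" "X = proj w" by (rule imageE)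
  then show ?thesis using snd_chart[OF assms(1)] by simp
qed

section \<open>Lifting curves to the group\<close>

definition lift_on :: "(real \<Rightarrow> 'e set) \<Rightarrow> real \<Rightarrow> real \<Rightarrow> (real \<Rightarrow> 'e) \<Rightarrow> bool" where
  "lift_on \<gamma> a b f \<longleftrightarrow> continuous_on {a..b} f \<and> (\<forall>t\<in>{a..b}. proj (f t) = \<gamma> t)"

lemma lift_on_subinterval: "lift_on \<gamma> a b f \<Longrightarrow> a \<le> a' \<Longrightarrow> b' \<le> b \<Longrightarrow> lift_on \<gamma> a' b' f"
  by (auto simp: lift_on_def intro: continuous_on_subset)

lemma lift_on_join:
  assumes "lift_on \<gamma> a b f" "lift_on \<gamma> b c g" "f b = g b" "a \<le> b" "b \<le> c"
  shows "\<exists>k. lift_on \<gamma> a c k \<and> k a = f a"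
proof (intro exI conjI)
  let ?k = "\<lambda>t. if t \<le> b then f t else g t"
  have "{a..c} = {a..b} \<union> {b..c}" using assms(4,5) by auto
  moreover have "continuous_on ({a..b} \<union> {b..c}) ?k"
    using assms by (intro continuous_on_cases) (auto simp: lift_on_def)
  ultimately show "lift_on \<gamma> a c ?k"
    using assms by (auto simp: lift_on_def)
  show "?k a = f a" using assms(4) by simp
qed

text \<open>By bisection: a short piece of the curve stays in one chart and is lifted by that local
  section, moved by a lattice element to the prescribed starting point. Lifts of adjacent pieces are
  joined.\<close>

lemma lift_exists:
  assumes "continuous_map (top_of_set {a..b}) (top_space Q) \<gamma>" "a \<le> b" "proj y = \<gamma> a"
  obtains f where "lift_on \<gamma> a b f" "f a = y"
proof -
  \<comment> \<open>All starting points are allowed so that lifts can be joined. The bounds make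
    \<open>P\<close> vacuous on intervals leaving \<open>{a..b}\<close>, which the local case of
    bisection also meets.\<close>
  define P where "P r s \<longleftrightarrow>
    (\<forall>y. a \<le> r \<and> s \<le> b \<and> proj y = \<gamma> r \<longrightarrow> (\<exists>f. lift_on \<gamma> r s f \<and> f r = y))" for r s
  from assms(2) have "P a b"
  proof (induction rule: Bolzano)
    case (trans r s t)
    show ?case
      unfolding P_def
    proof (intro allI impI)
      fix y assume y: "a \<le> r \<and> t \<le> b \<and> proj y = \<gamma> r"
      then obtain f where f: "lift_on \<gamma> r s f" "f r = y"
        using trans(1)[unfolded P_def, rule_format, of y] trans(4) by auto
      then have "proj (f s) = \<gamma> s" using trans by (simp add: lift_on_def)
      then obtain g where g: "lift_on \<gamma> s t g" "g s = f s"
        using trans(2)[unfolded P_def, rule_format, of "f s"] trans(3) y by auto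
      show "\<exists>f. lift_on \<gamma> r t f \<and> f r = y"
        using lift_on_join[OF f(1) g(1) g(2)[symmetric] trans(3,4)] f(2) by simp
    qed
  next
    case (local x)
    then have "\<gamma> x \<in> range proj"
      using continuous_map_image_subset_topspace[OF assms(1)] topspace_Q by auto
    then obtain w where "\<gamma> x = proj w" by blast
    then have "charts_at Q (\<gamma> x) \<noteq> {}" using charts_at_Q_nonempty[of w] by simp
    then obtain c where "c \<in> charts_at Q (\<gamma> x)" by blast
    then have c: "c \<in> atlas Q" "\<gamma> x \<in> fst c" by (auto simp: charts_at_def)
    have "openin (top_space Q) (fst c)"
      using openin_proj_image[OF open_cdom[OF c(1)]] unfolding fst_chart[OF c(1), symmetric] .
    then have "openin (top_of_set {a..b}) {t \<in> {a..b}. \<gamma> t \<in> fst c}"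
      using openin_continuous_map_preimage[OF assms(1)] by simp
    moreover have "x \<in> {t \<in> {a..b}. \<gamma> t \<in> fst c}" using local c(2) by simp
    ultimately have "\<exists>d>0. \<forall>t\<in>{a..b}. dist t x < d \<longrightarrow> t \<in> {t \<in> {a..b}. \<gamma> t \<in> fst c}"
      by (rule openin_euclidean_subtopology_iff[THEN iffD1, THEN conjunct2, rule_format])
    then obtain d where d: "d > 0" "\<And>t. t \<in> {a..b} \<Longrightarrow> dist t x < d \<Longrightarrow> \<gamma> t \<in> fst c"
      by blast
    show ?case
      unfolding P_def
    proof (intro exI[of _ d] conjI d(1) allI impI)
      fix r t y assume rt: "r \<le> x \<and> x \<le> t \<and> t - r < d" and y: "a \<le> r \<and> t \<le> b \<and> proj y = \<gamma> r"
      have in_c: "\<gamma> s \<in> fst c" if "s \<in> {r..t}" for s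
      proof (rule d(2))
        show "s \<in> {a..b}" using that y by simp
        show "dist s x < d" using that rt by (simp add: dist_real_def abs_if)
      qed
      have "continuous_map (top_of_set {r..t}) (subtopology (top_space Q) (fst c)) \<gamma>"
        using rt y in_c by (intro continuous_map_into_subtopology
          continuous_map_from_subtopology_mono[OF assms(1)]) auto
      then have "continuous_map (top_of_set {r..t}) euclidean (snd c \<circ> \<gamma>)"
        using continuous_map_chart[OF c(1)] continuous_map_compose by blast
      then have cont: "continuous_on {r..t} (\<lambda>s. snd c (\<gamma> s))"
        by (simp add: continuous_map_iff_continuous o_def)
      note proj_snd = proj_snd_chart[OF c(1)]
      have "proj (snd c (\<gamma> r)) = proj y" using proj_snd[OF in_c, of r] rt y by simp
      then obtain h where h: "h \<in> L" "y = h \<star> snd c (\<gamma> r)"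
        by (metis proj_eq_iff)
      have "lift_on \<gamma> r t (\<lambda>s. h \<star> snd c (\<gamma> s))"
        unfolding lift_on_def
        using continuous_on_gmul[OF continuous_on_const cont] proj_snd[OF in_c] proj_gmul[OF h(1)] by simp
      with h(2) show "\<exists>f. lift_on \<gamma> r t f \<and> f r = y" by blast
    qed
  qed
  then have "\<exists>f. lift_on \<gamma> a b f \<and> f a = y" unfolding P_def using assms(3) by simp
  with that show thesis by blast
qed

lemma unit_partition_mono:
  assumes "unit_partition n T" "i \<le> j" "j \<le> n"
  shows "T i \<le> T j"
  using assms(2,3)
proof (induction j rule: dec_induct)
  case (step j)
  have "T j < T (Suc j)" using assms(1) step.prems by (simp add: unit_partition_def)
  moreover have "T i \<le> T j" using step by simp
  ultimately show ?case by simp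
qed simp

lemma unit_partition_bounds:
  assumes "unit_partition n T" "i \<le> n"
  shows "0 \<le> T i" "T i \<le> 1"
  using unit_partition_mono[OF assms(1), of 0 i] unit_partition_mono[OF assms(1), of i n] assms
  by (auto simp: unit_partition_def)

lemma curve_lift:
  assumes "piecewise_C1_curve Q \<gamma>" "proj y = \<gamma> 0"
  obtains f where "lift_on \<gamma> 0 1 f" "f 0 = y"
proof -
  obtain n T where T: "unit_partition n T" "\<And>i. i < n \<Longrightarrow> C1_curve_on Q \<gamma> (T i) (T (Suc i))"
    using assms(1) by (auto simp: piecewise_C1_curve_def)
  have "\<exists>f. lift_on \<gamma> 0 (T i) f \<and> f 0 = y" if "i \<le> n" for i
    using that
  proof (induction i)
    case 0
    have "T 0 = 0" using T(1) by (simp add: unit_partition_def)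
    then show ?case
      using assms(2) by (intro exI[of _ "\<lambda>_. y"]) (simp add: lift_on_def)
  next
    case (Suc i)
    then obtain f where f: "lift_on \<gamma> 0 (T i) f" "f 0 = y" by auto
    have le: "0 \<le> T i" "T i \<le> T (Suc i)"
      using unit_partition_mono[OF T(1), of i "Suc i"] unit_partition_bounds[OF T(1), of i] Suc.prems
      by auto
    then have "proj (f (T i)) = \<gamma> (T i)" using f by (simp add: lift_on_def)
    moreover have "continuous_map (top_of_set {T i..T (Suc i)}) (top_space Q) \<gamma>"
      using T(2) Suc.prems by (simp add: C1_curve_on_def)
    ultimately obtain g where "lift_on \<gamma> (T i) (T (Suc i)) g" "g (T i) = f (T i)"
      using lift_exists le by metis
    then show ?case using lift_on_join[OF f(1)] le f(2) by force
  qed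
  moreover have "T n = 1" using T(1) by (simp add: unit_partition_def)
  ultimately show thesis using that by force
qed

text \<open>By continuity of \<open>f\<close>, one lattice translation relates the chart to the lift
  for all times near \<open>t\<close>.\<close>

lemma chart_along_lift:
  assumes "lift_on \<gamma> a b f" "t \<in> {a..b}" "c \<in> atlas Q" "\<gamma> t \<in> fst c"
  obtains d h where "d > 0"
    "\<And>s. s \<in> {a..b} \<Longrightarrow> dist s t < d \<Longrightarrow> \<gamma> s \<in> fst c \<and> snd c (\<gamma> s) = h \<star> f s"
proof -
  have f: "continuous_on {a..b} f" "\<And>s. s \<in> {a..b} \<Longrightarrow> proj (f s) = \<gamma> s"
    using assms(1) by (auto simp: lift_on_def)
  obtain U h where U: "open U" "f t \<in> U" "\<forall>y\<in>U. proj y \<in> fst c \<and> snd c (proj y) = h \<star> y"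
    using chart_lift[OF assms(3), of "f t"] assms f(2) by auto
  obtain e where e: "e > 0" "ball (f t) e \<subseteq> U" using U open_contains_ball by blast
  obtain d where d: "d > 0" "\<And>s. s \<in> {a..b} \<Longrightarrow> dist s t < d \<Longrightarrow> dist (f s) (f t) < e"
    using f(1) assms(2) e(1) unfolding continuous_on_iff by blast
  show thesis
  proof (rule that[OF d(1)])
    fix s assume s: "s \<in> {a..b}" "dist s t < d"
    then have "f s \<in> U" using d(2)[OF s] e(2) by (auto simp: dist_commute)
    then show "\<gamma> s \<in> fst c \<and> snd c (\<gamma> s) = h \<star> f s" using U(3) f(2)[OF s(1)] by metis
  qed
qed

section \<open>Parallel fields along lifts\<close>

lemma dproj_along_lift:
  assumes "snd c (\<gamma> s) = h \<star> x" "\<gamma> s \<in> fst c" "c \<in> atlas Q" "proj x = \<gamma> s"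
  shows "dproj x u c = rot (\<tau> h) u"
  using assms by (simp add: dproj_def charts_at_def)

text \<open>The Christoffel symbols vanish, so the velocity of the curve drops out of the
  equation.\<close>

lemma parallel_on_Q_iff:
  "parallel_on Q hQ \<gamma> V a b \<longleftrightarrow>
     (\<forall>t\<in>{a..b}. V t \<in> tangent_space Q (\<gamma> t) \<and>
        (\<forall>c\<in>charts_at Q (\<gamma> t). ((\<lambda>s. V s c) has_vector_derivative 0) (at t within {a..b})))"
proof -
  have "christoffel Q hQ c (snd c (\<gamma> t)) u v = 0" if "c \<in> charts_at Q (\<gamma> t)" for c t u v
    using that by (intro christoffel_Q) (auto simp: charts_at_def)
  then show ?thesis by (simp add: parallel_on_def cong: ball_cong)
qed

text \<open>Near each time the coordinate vector is \<open>rot (\<tau> h) u\<close> with a fixed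
  \<open>h\<close>, hence constant.\<close>

lemma parallel_on_dproj:
  assumes "lift_on \<gamma> a b f"
  shows "parallel_on Q hQ \<gamma> (\<lambda>t. dproj (f t) u) a b"
  unfolding parallel_on_Q_iff
proof (intro ballI conjI)
  fix t assume t: "t \<in> {a..b}"
  have pf: "\<And>s. s \<in> {a..b} \<Longrightarrow> proj (f s) = \<gamma> s" using assms by (simp add: lift_on_def)
  show "dproj (f t) u \<in> tangent_space Q (\<gamma> t)" using dproj_in_tangent_space[of "f t"] pf[OF t] by simp
  fix c assume "c \<in> charts_at Q (\<gamma> t)"
  then have c: "c \<in> atlas Q" "\<gamma> t \<in> fst c" by (auto simp: charts_at_def)
  obtain d h where d: "d > 0"
    "\<And>s. s \<in> {a..b} \<Longrightarrow> dist s t < d \<Longrightarrow> \<gamma> s \<in> fst c \<and> snd c (\<gamma> s) = h \<star> f s"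
    using chart_along_lift[OF assms t c] by metis
  have "((\<lambda>s. rot (\<tau> h) u) has_vector_derivative 0) (at t within {a..b})" by simp
  then show "((\<lambda>s. dproj (f s) u c) has_vector_derivative 0) (at t within {a..b})"
  proof (rule has_vector_derivative_transform_within[OF _ d(1) t])
    fix s assume s: "s \<in> {a..b}" "dist s t < d"
    then show "rot (\<tau> h) u = dproj (f s) u c"
      using dproj_along_lift[of c \<gamma> s h "f s" u] d(2)[OF s] c(1) pf[OF s(1)] by simp
  qed
qed

text \<open>Pulled back by \<open>dproj (f t)\<close>, the field becomes a vector function
  \<open>U\<close>. Near each time it is a fixed rotation of a coordinate vector with derivative
  zero, so \<open>U\<close> is constant.\<close>

lemma parallel_on_eq_dproj:
  assumes "lift_on \<gamma> a b f" "parallel_on Q hQ \<gamma> V a b"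
  obtains u where "\<And>t. t \<in> {a..b} \<Longrightarrow> V t = dproj (f t) u"
proof -
  have pf: "\<And>s. s \<in> {a..b} \<Longrightarrow> proj (f s) = \<gamma> s" using assms by (simp add: lift_on_def)
  have "\<exists>u. V t = dproj (f t) u" if "t \<in> {a..b}" for t
    using assms(2) that pf[OF that] tangent_space_Q[of "f t"] by (auto simp: parallel_on_Q_iff)
  then obtain U where U: "\<And>t. t \<in> {a..b} \<Longrightarrow> V t = dproj (f t) (U t)" by metis
  have "(U has_vector_derivative 0) (at t within {a..b})" if t: "t \<in> {a..b}" for t
  proof -
    obtain c where c': "c \<in> charts_at Q (\<gamma> t)" using charts_at_Q_nonempty[of "f t"] pf[OF t] by auto
    then have c: "c \<in> atlas Q" "\<gamma> t \<in> fst c" by (auto simp: charts_at_def)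
    obtain d h where d: "d > 0"
      "\<And>s. s \<in> {a..b} \<Longrightarrow> dist s t < d \<Longrightarrow> \<gamma> s \<in> fst c \<and> snd c (\<gamma> s) = h \<star> f s"
      using chart_along_lift[OF assms(1) t c] by metis
    have "((\<lambda>s. V s c) has_vector_derivative 0) (at t within {a..b})"
      using assms(2) t c' by (auto simp: parallel_on_Q_iff)
    then have "((\<lambda>s. rot (- \<tau> h) (V s c)) has_vector_derivative 0) (at t within {a..b})"
      using bounded_linear.has_vector_derivative[OF bounded_linear_rot] by fastforce
    then show ?thesis
    proof (rule has_vector_derivative_transform_within[OF _ d(1) t])
      fix s assume s: "s \<in> {a..b}" "dist s t < d"
      then show "rot (- \<tau> h) (V s c) = U s"
        using dproj_along_lift[of c \<gamma> s h "f s" "U s"] d(2)[OF s] c(1) pf[OF s(1)] U[OF s(1)] by simp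
    qed
  qed
  then obtain u where "\<And>t. t \<in> {a..b} \<Longrightarrow> U t = u"
    using has_vector_derivative_zero_constant[of "{a..b}" U] by auto
  with U that show thesis by metis
qed

text \<open>The constant vector \<open>u\<close> along the lift gives one parallel field. Any other
  with the same initial value may come with its own partition, and agreement with the first is
  carried from node to node.\<close>

lemma parallel_transport_lift:
  assumes "piecewise_C1_curve Q \<gamma>" "lift_on \<gamma> 0 1 f"
  shows "parallel_transport Q hQ \<gamma> (dproj (f 0) u) = dproj (f 1) u"
  unfolding parallel_transport_def
proof (rule the_equality)
  obtain n T where T: "unit_partition n T" "\<And>i. i < n \<Longrightarrow> C1_curve_on Q \<gamma> (T i) (T (Suc i))"
    using assms(1) by (auto simp: piecewise_C1_curve_def)
  have "parallel_on Q hQ \<gamma> (\<lambda>t. dproj (f t) u) (T i) (T (Suc i))" if "i < n" for i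
    using that unit_partition_bounds[OF T(1)]
    by (intro parallel_on_dproj lift_on_subinterval[OF assms(2)]) auto
  then show "\<exists>V. parallel_field Q hQ \<gamma> V \<and> V 0 = dproj (f 0) u \<and> V 1 = dproj (f 1) u"
    using T by (intro exI[of _ "\<lambda>t. dproj (f t) u"]) (auto simp: parallel_field_def)
next
  fix w assume "\<exists>V. parallel_field Q hQ \<gamma> V \<and> V 0 = dproj (f 0) u \<and> V 1 = w"
  then obtain V n T where V: "V 0 = dproj (f 0) u" "V 1 = w" and T: "unit_partition n T"
    "\<And>i. i < n \<Longrightarrow> parallel_on Q hQ \<gamma> V (T i) (T (Suc i))"
    by (auto simp: parallel_field_def)
  have "V (T i) = dproj (f (T i)) u" if "i \<le> n" for i
    using that
  proof (induction i)
    case 0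
    then show ?case using V T(1) by (simp add: unit_partition_def)
  next
    case (Suc i)
    have "lift_on \<gamma> (T i) (T (Suc i)) f"
      using unit_partition_bounds[OF T(1)] Suc.prems by (intro lift_on_subinterval[OF assms(2)]) auto
    then obtain v where v: "\<And>t. t \<in> {T i..T (Suc i)} \<Longrightarrow> V t = dproj (f t) v"
      using parallel_on_eq_dproj T(2)[of i] Suc.prems by (metis Suc_le_lessD)
    have le: "T i \<le> T (Suc i)" using unit_partition_mono[OF T(1), of i "Suc i"] Suc.prems by simp
    \<comment> \<open>Comparison at the common node identifies the constant vectors of adjacent
      pieces.\<close>
    then have "dproj (f (T i)) v = dproj (f (T i)) u" using v Suc by simp
    then have "v = u" using inj_dproj by (rule injD[rotated])
    then show ?case using v le by simp
  qed
  from this[of n] show "w = dproj (f 1) u" using V T(1) by (simp add: unit_partition_def)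
qed

text \<open>In a chart the curve is locally \<open>h \<star> (x + t *\<^sub>R w)\<close>, with
  velocity \<open>rot (\<tau> h) w\<close>. The formula \<open>?D\<close> expresses it without
  choosing \<open>h\<close>; it is continuous because it is locally constant.\<close>

lemma C1_curve_on_proj_line: "C1_curve_on Q (\<lambda>t. proj (x + t *\<^sub>R w)) a b"
  unfolding C1_curve_on_def
proof (intro conjI ballI)
  let ?g = "\<lambda>t. x + t *\<^sub>R w"
  have g: "continuous_on {a..b} ?g" by (intro continuous_intros)
  have "continuous_map (top_of_set {a..b}) euclidean ?g"
    using g by (simp add: continuous_map_iff_continuous)
  from continuous_map_compose[OF this continuous_map_proj]
  show "continuous_map (top_of_set {a..b}) (top_space Q) (\<lambda>t. proj (?g t))" by (simp add: o_def)
  have lift: "lift_on (\<lambda>t. proj (?g t)) a b ?g" using g by (simp add: lift_on_def)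
  fix c assume c: "c \<in> atlas Q"
  let ?I = "{t \<in> {a..b}. proj (?g t) \<in> fst c}"
  let ?D = "\<lambda>t. rot (\<tau> (snd c (proj (?g t))) - \<tau> (?g t)) w"
  have *: "((\<lambda>s. snd c (proj (?g s))) has_vector_derivative ?D t) (at t within {a..b}) \<and>
       continuous (at t within ?I) ?D"
    if t: "t \<in> {a..b}" "proj (?g t) \<in> fst c" for t
  proof -
    obtain d h where d: "d > 0" "\<And>s. s \<in> {a..b} \<Longrightarrow> dist s t < d \<Longrightarrow>
        proj (?g s) \<in> fst c \<and> snd c (proj (?g s)) = h \<star> ?g s"
      using chart_along_lift[OF lift t(1) c t(2)] by metis
    have D: "?D s = rot (\<tau> h) w" if "s \<in> {a..b}" "dist s t < d" for s
      using d(2)[OF that] by simp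
    have "((\<lambda>s. h \<star> ?g s) has_vector_derivative rot (\<tau> h) w) (at t within {a..b})"
      unfolding gmul_def by (auto intro!: derivative_eq_intros)
    then have "((\<lambda>s. snd c (proj (?g s))) has_vector_derivative rot (\<tau> h) w) (at t within {a..b})"
      by (rule has_vector_derivative_transform_within[OF _ d(1) t(1)]) (use d(2) in simp)
    moreover have "continuous (at t within ?I) ?D"
      by (rule continuous_transform_within[OF continuous_const[of _ "rot (\<tau> h) w"] d(1)])
        (use D t in auto)
    ultimately show ?thesis using D[OF t(1)] d(1) by simp
  qed
  show "\<exists>D. (\<forall>t\<in>{a..b}. proj (?g t) \<in> fst c \<longrightarrow>
            ((snd c \<circ> (\<lambda>t. proj (?g t))) has_vector_derivative D t) (at t within {a..b})) \<and>
        continuous_on ?I D"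
    using * by (intro exI[of _ ?D]) (auto simp: o_def continuous_on_eq_continuous_within)
qed

section \<open>The holonomy group as the integral rotations\<close>

definition hol :: "'e \<Rightarrow> real \<Rightarrow> ('e set, 'e) tvec \<Rightarrow> ('e set, 'e) tvec" where
  "hol x r = restrict (\<lambda>v. dproj x (rot r (inv_into UNIV (dproj x) v))) (tangent_space Q (proj x))"

lemma hol_dproj: "hol x r (dproj x u) = dproj x (rot r u)"
  by (simp add: hol_def dproj_in_tangent_space inv_f_f inj_dproj)

lemma hol_eqI:
  assumes "\<And>u. F (dproj x u) = dproj x (rot r u)"
  shows "restrict F (tangent_space Q (proj x)) = hol x r"
proof
  fix v show "restrict F (tangent_space Q (proj x)) v = hol x r v"
  proof (cases "v \<in> tangent_space Q (proj x)")
    case True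
    then show ?thesis using assms hol_dproj by (auto simp: tangent_space_Q)
  qed (simp add: hol_def)
qed

text \<open>A loop at \<open>proj x\<close> lifts to a path from \<open>x\<close> to some
  \<open>h \<star> x\<close>, and transport along it is \<open>rot (- \<tau> h)\<close>, with
  \<open>\<tau> h\<close> an integer. Conversely, the segment from \<open>x\<close> to
  \<open>h \<star> x\<close> projects to a loop.\<close>

lemma holonomy_carrier: "carrier (holonomy_group Q hQ (proj x)) = hol x ` \<int>"
proof (intro Set.set_eqI iffI)
  fix F assume "F \<in> carrier (holonomy_group Q hQ (proj x))"
  then obtain \<gamma> where \<gamma>: "piecewise_C1_curve Q \<gamma>" "\<gamma> 0 = proj x" "\<gamma> 1 = proj x"
    and F: "F = restrict (parallel_transport Q hQ \<gamma>) (tangent_space Q (proj x))"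
    by (auto simp: holonomy_group_def)
  obtain f where f: "lift_on \<gamma> 0 1 f" "f 0 = x"
    using curve_lift[OF \<gamma>(1) \<gamma>(2)[symmetric]] .
  then have "proj x = proj (f 1)" using \<gamma>(3) by (simp add: lift_on_def)
  then obtain h where h: "h \<in> L" "f 1 = h \<star> x"
    unfolding proj_eq_iff by (rule bexE)
  have "parallel_transport Q hQ \<gamma> (dproj x u) = dproj x (rot (- \<tau> h) u)" for u
    using parallel_transport_lift[OF \<gamma>(1) f(1), of u] f(2) h by (simp add: dproj_gmul)
  then have "F = hol x (- \<tau> h)" unfolding F by (rule hol_eqI)
  then show "F \<in> hol x ` \<int>" using \<tau>_L_Ints[OF h(1)] by simp
next
  fix F assume "F \<in> hol x ` \<int>"
  then obtain r where r: "r \<in> \<int>" "F = hol x r" by blast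
  \<comment> \<open>The sign compensates for that in \<open>dproj_gmul\<close>.\<close>
  then have "- r \<in> \<tau> ` L" using \<tau>_L by simp
  then obtain h where h: "h \<in> L" "\<tau> h = - r" by (elim imageE) simp
  define w where "w = h \<star> x - x"
  let ?\<gamma> = "\<lambda>t. proj (x + t *\<^sub>R w)"
  have C1: "piecewise_C1_curve Q ?\<gamma>"
    unfolding piecewise_C1_curve_def
    by (rule exI[of _ 1], rule exI[of _ real]) (simp add: unit_partition_def C1_curve_on_proj_line)
  have "lift_on ?\<gamma> 0 1 (\<lambda>t. x + t *\<^sub>R w)"
    by (auto simp: lift_on_def intro!: continuous_intros)
  from parallel_transport_lift[OF C1 this]
  have "parallel_transport Q hQ ?\<gamma> (dproj x u) = dproj x (rot r u)" for u
    using h dproj_gmul[of h x u] by (simp add: w_def)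
  then have "restrict (parallel_transport Q hQ ?\<gamma>) (tangent_space Q (proj x)) = hol x r"
    by (rule hol_eqI)
  moreover have "?\<gamma> 0 = proj x" "?\<gamma> 1 = proj x"
    using h by (simp_all add: w_def proj_gmul)
  ultimately have "\<exists>\<gamma>. F = restrict (parallel_transport Q hQ \<gamma>) (tangent_space Q (proj x)) \<and>
      piecewise_C1_curve Q \<gamma> \<and> \<gamma> 0 = proj x \<and> \<gamma> 1 = proj x"
    using C1 r(2) by (intro exI[of _ ?\<gamma>]) simp
  then show "F \<in> carrier (holonomy_group Q hQ (proj x))"
    by (simp add: holonomy_group_def)
qed

text \<open>The map \<open>i \<mapsto> hol x (of_int i)\<close> is a homomorphism from the integers
  onto the holonomy group, and by the second assumption its kernel consists of the multiples of
  \<open>n\<close>.\<close>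

lemma has_holonomy_group_cyclic:
  assumes "n > 0" "\<And>i. (\<forall>u. rot (of_int i) u = u) \<longleftrightarrow> int n dvd i"
  shows "has_holonomy_group Q hQ (integer_mod_group n)"
  unfolding has_holonomy_group_def topspace_Q
proof
  fix X assume "X \<in> range proj"
  then obtain x where X: "X = proj x" by blast
  let ?H = "holonomy_group Q hQ (proj x)"
  have eq: "hol x (of_int i) = hol x (of_int j) \<longleftrightarrow> int n dvd i - j" for i j
  proof -
    have "hol x (of_int i) = hol x (of_int j) \<longleftrightarrow> (\<forall>u. rot (of_int i) u = rot (of_int j) u)"
    proof (intro iffI allI)
      fix u assume "hol x (of_int i) = hol x (of_int j)"
      then have "hol x (of_int i) (dproj x u) = hol x (of_int j) (dproj x u)" by (rule fun_cong)
      then have "dproj x (rot (of_int i) u) = dproj x (rot (of_int j) u)" by (simp only: hol_dproj)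
      then show "rot (of_int i) u = rot (of_int j) u" by (rule injD[OF inj_dproj])
    qed (simp add: hol_def)
    also have "\<dots> \<longleftrightarrow> (\<forall>u. rot (of_int (i - j)) u = u)"
    proof
      assume *: "\<forall>u. rot (of_int i) u = rot (of_int j) u"
      show "\<forall>u. rot (of_int (i - j)) u = u"
      proof
        show "rot (of_int (i - j)) u = u" for u
          using *[rule_format, of "rot (- of_int j) u"] by simp
      qed
    next
      assume *: "\<forall>u. rot (of_int (i - j)) u = u"
      show "\<forall>u. rot (of_int i) u = rot (of_int j) u"
      proof
        show "rot (of_int i) u = rot (of_int j) u" for u
          using *[rule_format, of "rot (of_int j) u"] by simp
      qed
    qed
    finally show ?thesis unfolding assms(2) .
  qed
  have mult: "hol x r \<otimes>\<^bsub>?H\<^esub> hol x s = hol x (r + s)" for r s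
    unfolding holonomy_group_def compose_def by (simp add: hol_eqI hol_dproj)
  \<comment> \<open>The cyclic group is realised on the residues \<open>0, ..., n - 1\<close> with
    addition modulo \<open>n\<close>, so values must be insensitive to reduction.\<close>
  have red: "hol x (of_int (i mod int n)) = hol x (of_int i)" for i
    unfolding eq using mod_eq_dvd_iff[of "i mod int n" "int n" i] by simp
  have "(\<lambda>i. hol x (of_int i)) \<in> iso (integer_mod_group n) ?H"
    unfolding iso_def bij_betw_def mem_Collect_eq
  proof (intro conjI)
    show "(\<lambda>i. hol x (of_int i)) \<in> hom (integer_mod_group n) ?H"
      by (rule homI) (simp_all add: holonomy_carrier mult red flip: of_int_add)
    show "inj_on (\<lambda>i. hol x (of_int i)) (carrier (integer_mod_group n))"
    proof (rule inj_onI)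
      fix i j assume ij: "i \<in> carrier (integer_mod_group n)" "j \<in> carrier (integer_mod_group n)"
        "hol x (of_int i) = hol x (of_int j)"
      then have "i mod int n = j mod int n" using eq mod_eq_dvd_iff by metis
      then show "i = j" using ij assms(1) by (simp add: carrier_integer_mod_group)
    qed
    show "(\<lambda>i. hol x (of_int i)) ` carrier (integer_mod_group n) = carrier ?H"
    proof (intro equalityI subsetI)
      fix F assume "F \<in> carrier ?H"
      then obtain i where "F = hol x (of_int i)" by (auto simp: holonomy_carrier elim: Ints_cases)
      then have "F = hol x (of_int (i mod int n))" by (simp add: red)
      then show "F \<in> (\<lambda>i. hol x (of_int i)) ` carrier (integer_mod_group n)"
        using assms(1) by (intro image_eqI[of _ _ "i mod int n"]) (auto simp: carrier_integer_mod_group)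
    qed (auto simp: holonomy_carrier)
  qed
  then have "integer_mod_group n \<cong> ?H" by (auto simp: is_iso_def)
  then show "holonomy_group Q hQ X \<cong> integer_mod_group n"
    unfolding X by (rule group.iso_sym[OF group_integer_mod_group])
qed

end

section \<open>The shift of recurrent periodic sequences\<close>

text \<open>A geometric sum whose ratio is an \<open>n\<close>-th root of unity, equal to
  \<open>1\<close> exactly when \<open>n\<close> divides \<open>d\<close>.\<close>

lemma sum_cis_roots:
  assumes "n > 0"
  shows "(\<Sum>a<n. cis (2 * pi * of_int d * real a / real n)) = (if int n dvd d then of_nat n else 0)"
proof -
  let ?z = "cis (2 * pi * of_int d / real n)"
  have pow: "cis (2 * pi * of_int d * real a / real n) = ?z ^ a" for a
    by (simp add: Complex.DeMoivre mult_ac)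
  have "?z = 1 \<longleftrightarrow> int n dvd d"
  proof
    assume "?z = 1"
    then have "cos (2 * pi * of_int d / real n) = 1" by (metis cis.simps(1) one_complex.simps(1))
    then obtain k :: int where "2 * pi * of_int d / real n = of_int k * 2 * pi"
      using cos_one_2pi_int by auto
    then have "real_of_int d = of_int (int n * k)" using assms by (simp add: field_simps)
    then have "d = int n * k" by linarith
    then show "int n dvd d" by simp
  next
    assume "int n dvd d"
    then obtain k where "d = int n * k" by blast
    then have "2 * pi * of_int d / real n = 2 * pi * of_int k" using assms by simp
    then show "?z = 1" by (simp only: cis_multiple_2pi Ints_of_int)
  qed
  moreover have "?z ^ n = 1"
    using assms cis_multiple_2pi[of "of_int d"] by (simp add: pow[symmetric])
  ultimately show ?thesis
    by (simp add: pow sum_gp_strict)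
qed

lemma sum_periodic_shift:
  fixes g :: "int \<Rightarrow> 'a::comm_ring_1"
  assumes "\<And>a. g (a + int n) = g a"
  shows "(\<Sum>a<n. g (int a + int k)) = (\<Sum>a<n. g (int a))"
proof (induction k)
  case (Suc k)
  let ?h = "\<lambda>a. g (int a + int k)"
  have "?h 0 + (\<Sum>a<n. ?h (Suc a)) = (\<Sum>a<n. ?h a) + ?h n"
    using sum.lessThan_Suc_shift[of ?h n] by simp
  moreover have "?h n = ?h 0" using assms[of "int k"] by (simp add: add.commute)
  ultimately show ?case using Suc by (simp add: algebra_simps)
qed simp

lemma periodic_mult:
  fixes f :: "int \<Rightarrow> 'a"
  assumes "\<And>a. f (a + c) = f a"
  shows "f (a + c * k) = f a"
proof (induction k rule: int_induct[where k = 0])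
  case (step1 i)
  then show ?case using assms[of "a + c * i"] by (simp add: algebra_simps)
next
  case (step2 i)
  then show ?case using assms[of "a + c * (i - 1)"] by (simp add: algebra_simps)
qed simp

lemma periodic_mod:
  fixes f :: "int \<Rightarrow> 'a"
  assumes "\<And>a. f (a + c) = f a"
  shows "f (a mod c) = f a"
  using periodic_mult[of f c "a mod c" "a div c", OF assms] by simp

text \<open>The bijection \<open>b\<close> numbers the coordinates: the last one carries the linear
  form, the others the initial terms of a sequence. If half of \<open>p * q\<close> is an integer,
  \<open>parity\<close> makes it a multiple of \<open>p\<close>. The flag \<open>twist\<close>
  selects the negative of the shift.\<close>

locale cyclotomic =
  fixes p q :: nat and b :: "nat \<Rightarrow> 'n::finite" and twist :: bool
  assumes p_ge: "2 \<le> p" and q_ge: "1 \<le> q" and parity: "odd p \<or> even q"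
    and b_bij: "bij_betw b {..<(p - 1) * q + 1} UNIV"
    and twist_odd: "twist \<Longrightarrow> odd (p * q)"
begin

section \<open>Recurrent sequences\<close>

definition m :: nat where "m = (p - 1) * q"

definition N :: nat where "N = p * q"

lemma N_eq: "N = m + q"
  unfolding m_def N_def using p_ge by (cases p) simp_all

lemma m_pos: "0 < m" and N_pos: "0 < N"
  using p_ge q_ge by (simp_all add: m_def N_def)

lemma b_inj: "r \<le> m \<Longrightarrow> s \<le> m \<Longrightarrow> b r = b s \<longleftrightarrow> r = s"
  using b_bij by (auto simp: bij_betw_def inj_on_def m_def)

definition idx :: "'n \<Rightarrow> nat" where "idx = inv_into {..<m + 1} b"

lemma idx_b: "r \<le> m \<Longrightarrow> idx (b r) = r"
  using b_bij by (simp add: idx_def m_def bij_betw_def)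

lemma b_idx: "b (idx i) = i"
  using b_bij by (simp add: idx_def m_def bij_betw_def f_inv_into_f)

lemma idx_le: "idx i \<le> m"
  using b_bij inv_into_into[of i b "{..<m + 1}"] by (simp add: idx_def m_def bij_betw_def)

lemma idx_less: "i \<noteq> b m \<Longrightarrow> idx i < m"
  using idx_le[of i] b_idx[of i] by (cases "idx i = m") auto

definition tm :: "real ^ 'n \<Rightarrow> real" where "tm x = x $ b m"

text \<open>The last \<open>q\<close> terms of a period are forced: each is minus the sum of the
  \<open>p - 1\<close> earlier terms in its residue class modulo \<open>q\<close>.\<close>

definition ext :: "real ^ 'n \<Rightarrow> int \<Rightarrow> real" where
  "ext x a = (let r = nat (a mod int N) in
     if r < m then x $ b r else - (\<Sum>j<p - 1. x $ b (r - m + j * q)))"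

definition recurrent :: "(int \<Rightarrow> real) \<Rightarrow> bool" where
  "recurrent f \<longleftrightarrow> (\<forall>a. f (a + int N) = f a) \<and> (\<forall>a. (\<Sum>i<p. f (a + int (i * q))) = 0)"

lemma ext_b: "r < m \<Longrightarrow> ext x (int r) = x $ b r"
  by (simp add: ext_def N_eq)

text \<open>By periodicity the sum \<open>s a\<close> depends only on \<open>a\<close> modulo
  \<open>q\<close>. For \<open>0 \<le> a < q\<close> its last summand has index
  \<open>a + m\<close>, where \<open>ext\<close> is defined so as to cancel the others.\<close>

lemma recurrent_ext: "recurrent (ext x)"
proof -
  have per: "ext x (a + int N) = ext x a" for a by (simp add: ext_def)
  define s where "s a = (\<Sum>i<p. ext x (a + int (i * q)))" for a
  have "s (a + int q) = s a" for a
  proof -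
    let ?h = "\<lambda>i. ext x (a + int (i * q))"
    have "?h 0 + (\<Sum>i<p. ?h (Suc i)) = (\<Sum>i<p. ?h i) + ?h p"
      using sum.lessThan_Suc_shift[of ?h p] by simp
    moreover have "?h p = ?h 0" using per[of a] by (simp add: N_def)
    ultimately show ?thesis by (simp add: s_def algebra_simps)
  qed
  then have s_mod: "s (a mod int q) = s a" for a by (rule periodic_mod)
  have "s (int r) = 0" if "r < q" for r
  proof -
    have "p = Suc (p - 1)" using p_ge by simp
    then have "s (int r) = (\<Sum>i<p - 1. ext x (int (r + i * q))) + ext x (int (r + m))"
      unfolding s_def m_def by (metis (no_types, lifting) of_nat_add sum.cong sum.lessThan_Suc)
    moreover have "ext x (int (r + i * q)) = x $ b (r + i * q)" if "i < p - 1" for i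
    proof (rule ext_b)
      have "r + i * q < Suc i * q" using \<open>r < q\<close> by simp
      also have "Suc i * q \<le> (p - 1) * q" using that by (intro mult_le_mono1) simp
      finally show "r + i * q < m" by (simp add: m_def)
    qed
    moreover have "ext x (int (r + m)) = - (\<Sum>j<p - 1. x $ b (r + j * q))"
      using that by (simp add: ext_def N_eq nat_add_distrib)
    ultimately show ?thesis by simp
  qed
  from this[of "nat (a mod int q)" for a] have "s a = 0" for a
    using s_mod[of a] q_ge by (simp add: nat_less_iff)
  with per show ?thesis by (simp add: recurrent_def s_def)
qed

text \<open>The vanishing sums determine the last \<open>q\<close> terms of a period from the first
  \<open>m\<close>, and periodicity does the rest.\<close>

lemma ext_eqI:
  assumes "recurrent f" "\<And>r. r < m \<Longrightarrow> x $ b r = f (int r)"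
  shows "ext x = f"
proof
  fix a
  have per: "f (a + int N) = f a" for a using assms(1) by (simp add: recurrent_def)
  define r where "r = nat (a mod int N)"
  have r: "int r = a mod int N" "r < N" using N_pos by (simp_all add: r_def nat_less_iff)
  have fr: "f a = f (int r)" using periodic_mod[of f, OF per] r by simp
  show "ext x a = f a"
  proof (cases "r < m")
    case True
    then show ?thesis using assms(2) fr by (simp add: ext_def Let_def r_def[symmetric])
  next
    case False
    define s where "s = r - m"
    have s: "s < q" "r = s + m" using False r(2) by (simp_all add: s_def N_eq)
    have "p = Suc (p - 1)" using p_ge by simp
    moreover have "(\<Sum>i<p. f (int s + int (i * q))) = 0" using assms(1) by (simp add: recurrent_def)
    ultimately have "(\<Sum>i<p - 1. f (int s + int (i * q))) + f (int r) = 0"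
      unfolding s(2) m_def by (metis (no_types, lifting) of_nat_add sum.lessThan_Suc)
    moreover have "x $ b (s + i * q) = f (int s + int (i * q))" if "i < p - 1" for i
    proof -
      have "s + i * q < Suc i * q" using \<open>s < q\<close> by simp
      also have "Suc i * q \<le> (p - 1) * q" using that by (intro mult_le_mono1) simp
      finally show ?thesis using assms(2)[of "s + i * q"] by (simp add: m_def)
    qed
    ultimately show ?thesis
      using fr False by (simp add: ext_def Let_def r_def[symmetric] s_def[symmetric])
  qed
qed

section \<open>The discrete Fourier transform\<close>

definition w :: "int \<Rightarrow> int \<Rightarrow> complex" where
  "w l a = cis (2 * pi * of_int l * of_int a / real N)"

lemma w_add: "w l (a + c) = w l a * w l c" "w (l + k) a = w l a * w k a"
  by (simp_all add: w_def cis_mult algebra_simps add_divide_distrib)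

lemma w_minus: "w (- l) a = cnj (w l a)" "w l (- a) = cnj (w l a)"
  by (simp_all add: w_def cis_cnj)

lemma w_commute: "w l a = w a l"
  by (simp add: w_def mult_ac)

lemma w_eq_1: "int N dvd l * a \<Longrightarrow> w l a = 1"
proof -
  assume "int N dvd l * a"
  then obtain k where k: "l * a = int N * k" by blast
  have "2 * pi * of_int l * of_int a / real N = 2 * pi * of_int (l * a) / real N" by simp
  also have "\<dots> = 2 * pi * of_int k" unfolding k using N_pos by simp
  finally show ?thesis unfolding w_def by (simp only: cis_multiple_2pi Ints_of_int)
qed

lemma w_period: "w l (a + int N) = w l a"
  by (simp add: w_add w_eq_1)

lemma sum_w: "(\<Sum>a<N. w d (int a)) = (if int N dvd d then of_nat N else 0)"
  using sum_cis_roots[OF N_pos, of d] by (simp add: w_def)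

text \<open>The frequencies are represented symmetrically about \<open>0\<close>, so that reality of
  a sequence becomes conjugate symmetry of its coefficients.\<close>

definition S :: "int set" where "S = {l. 2 * \<bar>l\<bar> < int N \<and> \<not> int p dvd l}"

lemma finite_S: "finite S"
  by (rule finite_subset[of _ "{- int N..int N}"]) (auto simp: S_def)

lemma S_uminus: "- l \<in> S \<longleftrightarrow> l \<in> S"
  by (simp add: S_def)

lemma sum_S_uminus: "(\<Sum>l\<in>S. f (- l)) = (\<Sum>l\<in>S. f l)"
  by (rule sum.reindex_bij_witness[of _ uminus uminus]) (auto simp: S_uminus)

definition hat :: "real ^ 'n \<Rightarrow> int \<Rightarrow> complex" where
  "hat x l = (\<Sum>a<N. of_real (ext x (int a)) * w l (- int a)) / of_nat N"

lemma hat_uminus: "hat x (- l) = cnj (hat x l)"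
  by (simp add: hat_def w_minus)

text \<open>Such a character has period \<open>q\<close>. Averaging the transform over the
  translates by \<open>i * q\<close> therefore replaces the sequence by its vanishing sums.\<close>

lemma hat_eq_0:
  assumes "int p dvd l"
  shows "hat x l = 0"
proof -
  let ?g = "\<lambda>a. of_real (ext x a) * w l (- a)"
  have per: "?g (a + int N) = ?g a" for a
    using recurrent_ext[of x] w_period[of l "- a - int N"] by (simp add: recurrent_def)
  have w1: "w l (- (a + int (i * q))) = w l (- a)" for a i
    using w_eq_1[of l "- int (i * q)"] assms w_add(1)[of l "- a" "- int (i * q)"]
    by (simp add: N_def mult_dvd_mono)
  have "of_nat p * (\<Sum>a<N. ?g (int a)) = (\<Sum>i<p. \<Sum>a<N. ?g (int a + int (i * q)))"
    by (simp only: sum_periodic_shift[of ?g N, OF per] sum_constant card_lessThan)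
  also have "\<dots> = (\<Sum>a<N. \<Sum>i<p. ?g (int a + int (i * q)))"
    by (rule sum.swap)
  also have "\<dots> = (\<Sum>a<N. of_real (\<Sum>i<p. ext x (int a + int (i * q))) * w l (- int a))"
    by (simp only: w1 of_real_sum sum_distrib_right)
  also have "\<dots> = 0"
    using recurrent_ext[of x] unfolding recurrent_def by (intro sum.neutral) simp
  finally show ?thesis using p_ge by (simp add: hat_def)
qed

text \<open>Fourier inversion over a complete residue system \<open>?R\<close>; its members outside
  \<open>S\<close> are multiples of \<open>p\<close>, where the transform vanishes.\<close>

lemma ext_eq_sum_hat: "of_real (ext x a) = (\<Sum>l\<in>S. hat x l * w l a)"
proof -
  \<comment> \<open>This start centres \<open>N\<close> consecutive integers at \<open>0\<close>, so
    that they contain \<open>S\<close>; for even \<open>N\<close> they end at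
    \<open>N / 2\<close>.\<close>
  define c where "c = - ((int N - 1) div 2)"
  let ?R = "(\<lambda>i. c + int i) ` {..<N}"
  have S_R: "S \<subseteq> ?R"
  proof
    fix l assume "l \<in> S"
    then have "l = c + int (nat (l - c))" "nat (l - c) < N"
      unfolding S_def c_def by (auto simp: abs_if split: if_splits)
    then show "l \<in> ?R" by blast
  qed
  have R_S: "int p dvd l" if "l \<in> ?R - S" for l
  proof (rule ccontr)
    assume l: "\<not> int p dvd l"
    then have "2 * \<bar>l\<bar> \<ge> int N" using that by (simp add: S_def)
    moreover have "c \<le> l" "l < c + int N" using that by auto
    \<comment> \<open>The only candidate left is \<open>N / 2\<close>, which \<open>parity\<close>
      makes a multiple of \<open>p\<close>.\<close>
    ultimately have "2 * l = int N" unfolding c_def by presburger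
    then have 2: "2 * l = int p * int q" by (simp add: N_def)
    show False
    proof (cases "even q")
      case True
      then obtain k where "q = 2 * k" by blast
      with 2 l show False by simp
    next
      case False
      then have "odd p" using parity by simp
      then have "coprime (int p) 2" by simp
      moreover have "int p dvd 2 * l" using 2 by simp
      ultimately show False using l coprime_dvd_mult_right_iff by blast
    qed
  qed
  have orth: "(\<Sum>l\<in>?R. w l d) = (if int N dvd d then of_nat N else 0)" for d
  proof -
    have "(\<Sum>l\<in>?R. w l d) = (\<Sum>i<N. w (c + int i) d)"
      by (subst sum.reindex) (auto simp: inj_on_def)
    also have "\<dots> = w c d * (\<Sum>i<N. w d (int i))"
      by (simp add: w_add(2) sum_distrib_left w_commute[of "int _"])
    finally show ?thesis using w_eq_1[of c d] by (auto simp: sum_w)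
  qed
  have "(\<Sum>l\<in>S. hat x l * w l a) = (\<Sum>l\<in>?R. hat x l * w l a)"
    using S_R R_S hat_eq_0 by (intro sum.mono_neutral_left) auto
  also have "\<dots> = (\<Sum>l\<in>?R. \<Sum>j<N. of_real (ext x (int j)) * w l (a - int j) / of_nat N)"
    using w_add(1)[of _ "- int _" a]
    by (simp add: hat_def sum_divide_distrib sum_distrib_right sum_distrib_left mult_ac)
  also have "\<dots> = (\<Sum>j<N. of_real (ext x (int j)) * (\<Sum>l\<in>?R. w l (a - int j)) / of_nat N)"
    by (subst sum.swap) (simp add: sum_divide_distrib sum_distrib_left)
  also have "\<dots> = (\<Sum>j<N. if j = nat (a mod int N) then of_real (ext x (int j)) else 0)"
  proof (intro sum.cong refl)
    fix j assume "j \<in> {..<N}"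
    then have "int N dvd a - int j \<longleftrightarrow> j = nat (a mod int N)"
      using mod_eq_dvd_iff[of a "int N" "int j"] N_pos by auto
    then show "of_real (ext x (int j)) * (\<Sum>l\<in>?R. w l (a - int j)) / of_nat N
        = (if j = nat (a mod int N) then of_real (ext x (int j)) else (0::complex))"
      using N_pos by (simp add: orth)
  qed
  also have "\<dots> = of_real (ext x (a mod int N))"
    using N_pos by (simp add: sum.delta' nat_less_iff)
  also have "ext x (a mod int N) = ext x a"
    using recurrent_ext by (intro periodic_mod) (simp add: recurrent_def)
  finally show ?thesis by simp
qed

text \<open>By inversion, \<open>tm\<close> and \<open>hat\<close> on \<open>S\<close> serve as
  coordinates, in which the algebra of \<open>rot\<close> is checked below.\<close>

lemma vec_eqI:
  assumes "tm x = tm y" "\<And>l. l \<in> S \<Longrightarrow> hat x l = hat y l"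
  shows "x = y"
proof -
  have "of_real (ext x a) = (of_real (ext y a) :: complex)" for a
    unfolding ext_eq_sum_hat using assms(2) by simp
  then have e: "ext x a = ext y a" for a by simp
  have "x $ i = y $ i" for i
  proof (cases "i = b m")
    case True
    then show ?thesis using assms(1) by (simp add: tm_def)
  next
    case False
    then show ?thesis using e[of "int (idx i)"] idx_less[OF False] by (simp add: ext_b b_idx)
  qed
  then show ?thesis by (simp add: vec_eq_iff)
qed

text \<open>The inverse transform. For conjugate symmetric \<open>z\<close> the sum is already real,
  so \<open>Re\<close> only adjusts the type.\<close>

definition syn :: "real \<Rightarrow> (int \<Rightarrow> complex) \<Rightarrow> real ^ 'n" where
  "syn t z = (\<chi> i. if i = b m then t else Re (\<Sum>l\<in>S. z l * w l (int (idx i))))"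

text \<open>Conjugate symmetry makes the sum real, and frequencies prime to the relation make it
  recurrent in the sense that its class sums vanish; \<open>ext_eqI\<close> then identifies it.
  Orthogonality of characters returns the coefficients.\<close>

lemma
  assumes sym: "\<And>l. l \<in> S \<Longrightarrow> z (- l) = cnj (z l)"
  shows ext_syn: "of_real (ext (syn t z) a) = (\<Sum>l\<in>S. z l * w l a)"
    and hat_syn: "k \<in> S \<Longrightarrow> hat (syn t z) k = z k"
proof -
  let ?s = "\<lambda>a. \<Sum>l\<in>S. z l * w l a"
  have "cnj (?s a) = ?s a" for a
  proof -
    have "cnj (?s a) = (\<Sum>l\<in>S. z (- l) * w (- l) a)"
      by (simp add: w_minus sym)
    then show ?thesis by (simp only: sum_S_uminus[of "\<lambda>l. z l * w l a"])
  qed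
  then have real: "of_real (Re (?s a)) = ?s a" for a
    by (metis Reals_cnj_iff complex_is_Real_iff of_real_Re)
  have "(\<Sum>i<p. ?s (a + int (i * q))) = 0" for a
  proof -
    have "(\<Sum>i<p. w l (int (i * q))) = 0" if "l \<in> S" for l
    proof -
      \<comment> \<open>On multiples of \<open>q\<close> the character takes powers of a
        \<open>p\<close>-th root of unity, different from \<open>1\<close> since \<open>p\<close>
        does not divide \<open>l\<close>.\<close>
      have "w l (int (i * q)) = cis (2 * pi * of_int l * real i / real p)" for i
        using q_ge by (simp add: w_def N_def field_simps)
      then show ?thesis using sum_cis_roots[of p l] that p_ge by (simp add: S_def)
    qed
    moreover have "(\<Sum>i<p. ?s (a + int (i * q))) = (\<Sum>l\<in>S. z l * w l a * (\<Sum>i<p. w l (int (i * q))))"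
      by (subst sum.swap) (simp add: w_add(1) sum_distrib_left mult_ac)
    ultimately show ?thesis by simp
  qed
  then have "(\<Sum>i<p. Re (?s (a + int (i * q)))) = 0" for a
    by (metis Re_sum zero_complex.simps(1))
  then have "recurrent (\<lambda>a. Re (?s a))"
    by (simp add: recurrent_def w_period)
  then have "ext (syn t z) = (\<lambda>a. Re (?s a))"
    by (rule ext_eqI) (simp add: syn_def b_inj idx_b)
  then show ext: "of_real (ext (syn t z) a) = ?s a" for a using real by simp
  assume k: "k \<in> S"
  have "hat (syn t z) k = (\<Sum>a<N. \<Sum>l\<in>S. z l * w (l - k) (int a)) / of_nat N"
    using w_add(2)[of _ "- k"] by (simp add: hat_def ext w_minus sum_distrib_right sum_distrib_left mult_ac)
  also have "\<dots> = (\<Sum>l\<in>S. z l * (\<Sum>a<N. w (l - k) (int a))) / of_nat N"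
    by (subst sum.swap) (simp add: sum_distrib_left)
  also have "\<dots> = (\<Sum>l\<in>S. if l = k then z l * of_nat N else 0) / of_nat N"
  proof (intro arg_cong2[where f = "(/)"] sum.cong refl)
    fix l assume "l \<in> S"
    \<comment> \<open>Distinct members of \<open>S\<close> are therefore incongruent modulo
      \<open>N\<close>.\<close>
    then have "\<bar>l - k\<bar> < int N" using k by (auto simp: S_def)
    then have "int N dvd l - k \<longleftrightarrow> l = k"
      using zdvd_not_zless[of "\<bar>l - k\<bar>" "int N"] by auto
    then show "z l * (\<Sum>a<N. w (l - k) (int a)) = (if l = k then z l * of_nat N else 0)"
      by (simp add: sum_w)
  qed
  also have "\<dots> = z k" using k finite_S N_pos by (simp add: sum.delta)
  finally show "hat (syn t z) k = z k" .
qed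

lemma tm_syn: "tm (syn t z) = t"
  by (simp add: tm_def syn_def)

section \<open>The one-parameter group through the shift\<close>

definition ang :: "int \<Rightarrow> real" where
  "ang l = 2 * pi * of_int l / real N + (if twist then pi * of_int (sgn l) else 0)"

definition rot :: "real \<Rightarrow> real ^ 'n \<Rightarrow> real ^ 'n" where
  "rot t x = syn (tm x) (\<lambda>l. cis (ang l * t) * hat x l)"

text \<open>The speed is odd in \<open>l\<close>, so rotated coefficients still belong to a real
  vector. This is why the twist uses \<open>sgn l\<close> and not a constant.\<close>

lemma rot_sym: "cis (ang (- l) * t) * hat x (- l) = cnj (cis (ang l * t) * hat x l)"
  by (simp add: hat_uminus cis_cnj ang_def algebra_simps)

lemma hat_rot: "l \<in> S \<Longrightarrow> hat (rot t x) l = cis (ang l * t) * hat x l"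
  unfolding rot_def by (rule hat_syn) (simp_all only: rot_sym)

lemma ext_rot: "of_real (ext (rot t x) a) = (\<Sum>l\<in>S. cis (ang l * t) * hat x l * w l a)"
  unfolding rot_def by (rule ext_syn) (simp only: rot_sym)

lemma tm_rot: "tm (rot t x) = tm x"
  by (simp add: rot_def tm_syn)

lemma tm_add: "tm (x + y) = tm x + tm y" and tm_scaleR: "tm (r *\<^sub>R x) = r * tm x"
  by (simp_all add: tm_def)

lemma linear_tm: "linear tm"
  by (rule linearI) (simp_all add: tm_add tm_scaleR)

lemma ext_add: "ext (x + y) a = ext x a + ext y a"
  by (simp add: ext_def Let_def sum.distrib)

lemma ext_scaleR: "ext (r *\<^sub>R x) a = r * ext x a"
  by (simp add: ext_def Let_def sum_distrib_left)

lemma hat_add: "hat (x + y) l = hat x l + hat y l"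
  by (simp add: hat_def ext_add sum.distrib algebra_simps add_divide_distrib)

lemma hat_scaleR: "hat (r *\<^sub>R x) l = of_real r * hat x l"
  by (simp add: hat_def ext_scaleR sum_distrib_left mult_ac)

lemma linear_rot: "linear (rot t)"
  by (rule linearI; rule vec_eqI)
    (simp_all add: tm_rot tm_add tm_scaleR hat_rot hat_add hat_scaleR algebra_simps)

lemma rot_0: "rot 0 x = x"
  by (rule vec_eqI) (simp_all add: tm_rot hat_rot)

lemma rot_rot: "rot s (rot t x) = rot (s + t) x"
  by (rule vec_eqI) (simp_all add: tm_rot hat_rot cis_mult algebra_simps flip: mult.assoc)

text \<open>In Fourier coordinates \<open>rot\<close> multiplies by complex numbers of modulus one,
  so this form is invariant.\<close>

definition ip :: "real ^ 'n \<Rightarrow> real ^ 'n \<Rightarrow> real" where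
  "ip x y = tm x * tm y + (\<Sum>l\<in>S. Re (hat x l * cnj (hat y l)))"

lemma ip_sym: "ip x y = ip y x"
  by (simp add: ip_def mult.commute)

lemma bilinear_ip: "bilinear ip"
proof -
  have "linear (ip x)" for x
    by (rule linearI)
      (simp_all add: ip_def tm_add tm_scaleR hat_add hat_scaleR sum.distrib sum_distrib_left algebra_simps)
  then show ?thesis
    unfolding bilinear_def using ip_sym by (metis (no_types, lifting) ext linear_compose)
qed

lemma ip_pos:
  assumes "x \<noteq> 0" shows "0 < ip x x"
proof -
  have sq: "Re (hat x l * cnj (hat x l)) = (cmod (hat x l))\<^sup>2" for l
    by (simp add: complex_mult_cnj cmod_power2)
  have "ip x x = (tm x)\<^sup>2 + (\<Sum>l\<in>S. (cmod (hat x l))\<^sup>2)"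
    by (simp only: ip_def sq power2_eq_square)
  moreover have "tm x \<noteq> 0 \<or> (\<exists>l\<in>S. hat x l \<noteq> 0)"
  proof (rule ccontr)
    assume "\<not> ?thesis"
    then have "x = 0 *\<^sub>R x"
      by (intro vec_eqI) (simp_all only: tm_scaleR hat_scaleR of_real_0 mult_zero_left, auto)
    then show False using assms by simp
  qed
  moreover have "0 \<le> (\<Sum>l\<in>S. (cmod (hat x l))\<^sup>2)" by (simp add: sum_nonneg)
  moreover have "0 < (\<Sum>l\<in>S. (cmod (hat x l))\<^sup>2)" if "l \<in> S" "hat x l \<noteq> 0" for l
    using finite_S that by (intro sum_pos2[of S l]) simp_all
  ultimately show ?thesis
    by (metis add.commute add_nonneg_pos add_pos_nonneg zero_le_power2 zero_less_power2)
qed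

lemma ip_rot: "ip (rot t x) (rot t y) = ip x y"
proof -
  have "cis a * u * cnj (cis a * v) = u * cnj v" for a u v
  proof -
    have "cis a * u * cnj (cis a * v) = (cis a * cnj (cis a)) * (u * cnj v)"
      by (simp only: complex_cnj_mult mult_ac)
    then show ?thesis by (simp add: cis_cnj cis_mult)
  qed
  then show ?thesis unfolding ip_def tm_rot by (simp only: hat_rot cong: sum.cong)
qed

section \<open>Integer times: the shift up to sign\<close>

definition sg :: "int \<Rightarrow> real" where
  "sg k = (if twist \<and> odd k then - 1 else 1)"

text \<open>Since \<open>0\<close> is not in \<open>S\<close>, the twist contributes the phase
  \<open>\<plusminus> pi * k\<close>, and both signs give the same factor.\<close>

lemma cis_ang_int:
  assumes "l \<in> S" shows "cis (ang l * of_int k) = of_real (sg k) * w l k"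
proof -
  have "l \<noteq> 0" using assms by (auto simp: S_def)
  then have "sgn l = 1 \<or> sgn l = - 1" by (auto simp: sgn_if)
  then have "cis (pi * of_int (sgn l) * of_int k) = (if even k then 1 else - 1)"
    by (auto simp: complex_eq_iff cos_npi_int sin_npi_int)
  moreover have "cis (ang l * of_int k)
      = w l k * (if twist then cis (pi * of_int (sgn l) * of_int k) else 1)"
    by (simp add: ang_def w_def cis_mult algebra_simps)
  ultimately show ?thesis by (simp add: sg_def)
qed

text \<open>Multiplying the coefficients by the phases \<open>w l k\<close> translates the sequence
  by \<open>k\<close>.\<close>

lemma ext_rot_int: "ext (rot (of_int k) x) a = sg k * ext x (a + k)"
proof -
  have "complex_of_real (ext (rot (of_int k) x) a) = of_real (sg k) * of_real (ext x (a + k))"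
    unfolding ext_rot ext_eq_sum_hat[of x] sum_distrib_left
    by (intro sum.cong refl) (simp only: cis_ang_int w_add(1), simp only: mult_ac)
  then show ?thesis by (metis of_real_eq_iff of_real_mult)
qed

lemma nth_eq_ext: "i \<noteq> b m \<Longrightarrow> x $ i = ext x (int (idx i))"
  by (simp add: ext_b idx_less b_idx)

section \<open>The integral lattice\<close>

definition L :: "(real ^ 'n) set" where "L = {x. \<forall>i. x $ i \<in> \<int>}"

lemma ext_L: "x \<in> L \<Longrightarrow> ext x a \<in> \<int>"
  by (auto simp: ext_def L_def Let_def)

lemma L_rot:
  assumes "x \<in> L" "r \<in> \<int>" shows "rot r x \<in> L"
proof -
  obtain k where k: "r = of_int k" using assms(2) by (rule Ints_cases)
  have "rot r x $ i \<in> \<int>" for i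
  proof (cases "i = b m")
    case True
    then show ?thesis using assms(1) tm_rot[of r x] by (simp add: tm_def L_def)
  next
    case False
    then show ?thesis
      using ext_L[OF assms(1)] by (simp add: nth_eq_ext k ext_rot_int sg_def)
  qed
  then show ?thesis by (simp add: L_def)
qed

lemma tm_L: "tm ` L = \<int>"
proof (intro equalityI subsetI)
  fix r :: real assume "r \<in> \<int>"
  then have "axis (b m) r \<in> L" "tm (axis (b m) r) = r"
    by (auto simp: L_def tm_def axis_def)
  then show "r \<in> tm ` L" by (metis imageI)
qed (auto simp: L_def tm_def)

lemma L_discrete: "\<exists>e>0. \<forall>x\<in>L. norm x < e \<longrightarrow> x = 0"
proof (intro exI[of _ 1] conjI ballI impI)
  fix x :: "real ^ 'n" assume x: "x \<in> L" "norm x < 1"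
  have "x $ i = 0" for i
  proof -
    have "\<bar>x $ i\<bar> < 1" using component_le_norm_cart[of x i] x(2) by simp
    moreover have "x $ i \<in> \<int>" using x(1) by (simp add: L_def)
    ultimately show ?thesis by (auto elim!: Ints_cases)
  qed
  then show "x = 0" by (simp add: vec_eq_iff)
qed simp

lemma L_cocompact: "\<exists>K. compact K \<and> (\<forall>x. \<exists>h\<in>L. h + rot (tm h) x \<in> K)"
proof (intro exI[of _ "cbox 0 1"] conjI allI compact_cbox)
  fix x :: "real ^ 'n"
  \<comment> \<open>The unit cube serves as \<open>K\<close>. Moving \<open>tm x\<close> into the
    unit interval fixes the rotation; the other coordinates of \<open>h\<close> then remove integer
    parts of the rotated vector.\<close>
  define n where "n = - \<lfloor>tm x\<rfloor>"
  define h :: "real ^ 'n" where "h = (\<chi> i. if i = b m then of_int n else - of_int \<lfloor>rot (of_int n) x $ i\<rfloor>)"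
  have h: "tm h = of_int n" by (simp add: tm_def h_def)
  have *: "0 \<le> r - of_int \<lfloor>r\<rfloor> \<and> r - of_int \<lfloor>r\<rfloor> \<le> 1" for r :: real
    by linarith
  have "0 \<le> (h + rot (tm h) x) $ i \<and> (h + rot (tm h) x) $ i \<le> 1" for i
  proof (cases "i = b m")
    case True
    then show ?thesis using *[of "tm x"] tm_rot[of "of_int n" x] h
      by (simp add: tm_def n_def)
  next
    case False
    then show ?thesis using *[of "rot (of_int n) x $ i"] unfolding h by (simp add: h_def)
  qed
  moreover have "h \<in> L" by (simp add: h_def L_def)
  ultimately show "\<exists>h\<in>L. h + rot (tm h) x \<in> cbox 0 1"
    by (intro bexI[of _ h]) (auto simp: mem_box_cart)
qed

text \<open>The real part of \<open>cis a * z\<close> is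
  \<open>cos a * Re z + cos (a + pi / 2) * Im z\<close>, so each frequency contributes products of a
  cosine and a linear map.\<close>

lemma smooth_rot: "smooth_on UNIV (\<lambda>z. rot (tm (fst z)) (snd z))"
proof -
  define P where "P x = axis (b m) (tm x)" for x :: "real ^ 'n"
  define R where "R l x = (\<chi> i. if i = b m then 0 else Re (hat x l * w l (int (idx i))))" for l x
  define J where "J l x = (\<chi> i. if i = b m then 0 else Im (hat x l * w l (int (idx i))))" for l x
  have lin: "bounded_linear (\<lambda>z. P (snd z))" "bounded_linear (\<lambda>z. R l (snd z))"
    "bounded_linear (\<lambda>z. J l (snd z))" "bounded_linear (\<lambda>z. ang l * tm (fst z))" for l
  proof -
    have "linear P" "linear (R l)" "linear (J l)" "linear (\<lambda>x. ang l * tm x)"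
      by (rule linearI; simp add: P_def R_def J_def tm_add tm_scaleR hat_add hat_scaleR vec_eq_iff
        axis_def algebra_simps)+
    then show "bounded_linear (\<lambda>z. P (snd z))" "bounded_linear (\<lambda>z. R l (snd z))"
    "bounded_linear (\<lambda>z. J l (snd z))" "bounded_linear (\<lambda>z. ang l * tm (fst z))"
      using bounded_linear_compose[OF _ bounded_linear_fst] bounded_linear_compose[OF _ bounded_linear_snd]
      by (simp_all add: linear_conv_bounded_linear)
  qed
  have "rot t x = P x + (\<Sum>l\<in>S. cos (ang l * t + 0) *\<^sub>R R l x + cos (ang l * t + pi / 2) *\<^sub>R J l x)"
    for t x
  proof -
    have "Re (cis a * u * v) = cos a * Re (u * v) + cos (a + pi / 2) * Im (u * v)" for a u v
      by (simp add: cos_add mult.assoc)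
    then show ?thesis
      by (simp add: vec_eq_iff rot_def syn_def P_def R_def J_def axis_def)
  qed
  then have eq: "(\<lambda>z. rot (tm (fst z)) (snd z)) = (\<lambda>z. P (snd z) +
      (\<Sum>l\<in>S. cos (ang l * tm (fst z) + 0) *\<^sub>R R l (snd z)
        + cos (ang l * tm (fst z) + pi / 2) *\<^sub>R J l (snd z)))"
    by (rule ext)
  show ?thesis
    unfolding eq
    by (intro smooth_on_add smooth_on_sum smooth_on_cos_linear smooth_on_linear lin open_UNIV)
qed

section \<open>The order of the time-one map\<close>

definition period :: nat where "period = (if twist then 2 * N else N)"

lemma period_pos: "0 < period"
  using N_pos by (simp add: period_def)

lemma rot_int_id: "(\<forall>x. rot (of_int k) x = x) \<longleftrightarrow> int period dvd k"
proof
  assume *: "int period dvd k"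
  have "int N dvd int period" by (simp add: period_def)
  with * have "int N dvd k" by (rule dvd_trans[rotated])
  moreover have "even k" if twist
  proof -
    have "2 dvd int period" unfolding period_def using that by simp
    with * show ?thesis by (rule dvd_trans[rotated])
  qed
  ultimately have k: "int N dvd k" "sg k = 1" by (simp_all add: sg_def)
  show "\<forall>x. rot (of_int k) x = x"
  proof
    fix x
    have "ext x (a + k) = ext x a" for a
    proof -
      obtain j where "k = int N * j" using k(1) by blast
      then show ?thesis
        using periodic_mult[of "ext x" "int N" a j] recurrent_ext[of x] by (simp add: recurrent_def)
    qed
    then have "rot (of_int k) x $ i = x $ i" for i
      using tm_rot[of "of_int k" x] k(2) by (cases "i = b m") (simp_all add: nth_eq_ext ext_rot_int tm_def)
    then show "rot (of_int k) x = x" by (simp add: vec_eq_iff)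
  qed
next
  assume id: "\<forall>x. rot (of_int k) x = x"
  \<comment> \<open>The sequence of this test vector is \<open>1\<close> exactly at multiples of
    \<open>N\<close>; it is \<open>- 1\<close> at \<open>m\<close> modulo \<open>N\<close>.\<close>
  let ?u = "axis (b 0) 1 :: real ^ 'n"
  have u0: "ext ?u 0 = 1" using ext_b[of 0 ?u] m_pos by simp
  have u1: "int N dvd a" if "ext ?u a = 1" for a
  proof -
    define r where "r = nat (a mod int N)"
    have "r = 0"
    proof (rule ccontr)
      assume r: "r \<noteq> 0"
      have ext_u: "ext ?u a = (if r < m then ?u $ b r else - (\<Sum>j<p - 1. ?u $ b (r - m + j * q)))"
        unfolding ext_def Let_def r_def ..
      have "ext ?u a \<le> 0"
      proof (cases "r < m")
        case True
        then have "?u $ b r = 0" using r b_inj[of r 0] by (simp add: axis_def)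
        then show ?thesis unfolding ext_u using True by simp
      next
        case False
        have "0 \<le> (\<Sum>j<p - 1. ?u $ b (r - m + j * q))"
          by (intro sum_nonneg) (simp add: axis_def)
        then show ?thesis unfolding ext_u if_not_P[OF False] neg_le_0_iff_le .
      qed
      with that show False by simp
    qed
    then have "a mod int N \<le> 0" by (simp add: r_def)
    moreover have "0 \<le> a mod int N" using N_pos by simp
    ultimately show ?thesis by (simp add: dvd_eq_mod_eq_0)
  qed
  have sk: "sg k * ext ?u k = 1" using id ext_rot_int[of k ?u 0] u0 by simp
  show "int period dvd k"
  proof (cases "twist")
    case False
    then show ?thesis using sk u1 unfolding period_def sg_def by simp
  next
    case True
    then have odd: "odd N" using twist_odd unfolding N_def by simp
    \<comment> \<open>For odd \<open>k\<close> the sign could be cancelled by a term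
      \<open>- 1\<close>. Doubling removes the sign, and oddness of \<open>N\<close> then gives
      \<open>N\<close> dividing \<open>k\<close>.\<close>
    have "rot (of_int (2 * k)) ?u = ?u"
      using id rot_rot[of "of_int k" "of_int k" ?u] by simp
    then have "int N dvd 2 * k"
      using ext_rot_int[of "2 * k" ?u 0] u0 u1[of "2 * k"] unfolding sg_def by simp
    moreover have "coprime (int N) 2" using odd by simp
    ultimately have N: "int N dvd k" using coprime_dvd_mult_right_iff by blast
    then obtain j where "k = int N * j" by blast
    then have "ext ?u k = 1"
      using periodic_mult[of "ext ?u" "int N" 0 j] recurrent_ext[of ?u] u0 by (simp add: recurrent_def)
    with sk have "sg k = 1" by simp
    then have "even k" using True unfolding sg_def by (cases "even k") simp_all
    then show ?thesis
      unfolding period_def using True N \<open>coprime (int N) 2\<close>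
      by (simp add: divides_mult coprime_commute)
  qed
qed

end

section \<open>Flat solvmanifolds with cyclic holonomy\<close>

lemma (in cyclotomic) ex_flat_solvmanifold:
  "\<exists>(Q :: ((real^'n) set, real^'n) manifold) h.
     flat_solvmanifold Q h \<and> has_holonomy_group Q h (integer_mod_group period)"
proof -
  interpret screw: screw_lattice rot tm ip L
    by (rule screw_lattice.intro)
      (simp_all add: linear_rot rot_0 rot_rot linear_tm tm_rot smooth_rot bilinear_ip
        ip_sym ip_pos ip_rot L_rot tm_L L_discrete L_cocompact, simp_all add: L_def)
  show ?thesis
    using screw.flat_solvmanifold_Q screw.has_holonomy_group_cyclic[OF period_pos rot_int_id] by blast
qed

lemma ex_flat_solvmanifold_cyclic:
  fixes p q :: nat
  assumes "2 \<le> p" "1 \<le> q" "odd p \<or> even q" "twist \<Longrightarrow> odd (p * q)"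
    and dim: "CARD('n::finite) = (p - 1) * q + 1"
  shows "\<exists>(Q :: ((real^'n) set, real^'n) manifold) h. flat_solvmanifold Q h \<and>
     has_holonomy_group Q h (integer_mod_group (if twist then 2 * (p * q) else p * q))"
proof -
  obtain b where "bij_betw b {0..<CARD('n)} (UNIV :: 'n set)"
    using ex_bij_betw_nat_finite[OF finite] by blast
  then interpret cyclotomic p q b twist
    using assms by unfold_locales (simp_all add: lessThan_atLeast0)
  show ?thesis using ex_flat_solvmanifold unfolding period_def N_def .
qed

theorem theorem3p9:
  fixes p k :: nat
  assumes "prime p" and "k \<ge> 1"
    and dim: "CARD('n::finite) = (p - 1) * p ^ (k - 1) + 1"
  shows "(odd p \<longrightarrow>
            (\<exists>(Q :: ((real^'n) set, real^'n) manifold) h.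
               flat_solvmanifold Q h \<and> has_holonomy_group Q h (integer_mod_group (p ^ k))) \<and>
            (\<exists>(Q :: ((real^'n) set, real^'n) manifold) h.
               flat_solvmanifold Q h \<and> has_holonomy_group Q h (integer_mod_group (2 * p ^ k)))) \<and>
         (p = 2 \<and> k \<ge> 2 \<longrightarrow>
            (\<exists>(Q :: ((real^'n) set, real^'n) manifold) h.
               flat_solvmanifold Q h \<and> has_holonomy_group Q h (integer_mod_group (p ^ k))))"
proof -
  \<comment> \<open>This makes the period \<open>p ^ k\<close>. For odd \<open>p\<close> the product
    \<open>p * q\<close> is odd, as the twist requires; for \<open>p = 2\<close> the parity
    condition asks for even \<open>q\<close>, which \<open>k \<ge> 2\<close> provides.\<close>
  define q where "q = p ^ (k - 1)"
  have p: "2 \<le> p" using assms(1) by (rule prime_ge_2_nat)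
  then have q: "1 \<le> q" by (simp add: q_def)
  have pk: "p ^ k = p * q" using assms(2) by (cases k) (simp_all add: q_def)
  have dim': "CARD('n) = (p - 1) * q + 1" using dim by (simp add: q_def)
  note ex = ex_flat_solvmanifold_cyclic[OF p q _ _ dim']
  show ?thesis
    unfolding pk
  proof (intro conjI impI)
    assume "odd p"
    then show "\<exists>(Q :: ((real^'n) set, real^'n) manifold) h.
        flat_solvmanifold Q h \<and> has_holonomy_group Q h (integer_mod_group (p * q))"
      using ex[of False] by simp
    show "\<exists>(Q :: ((real^'n) set, real^'n) manifold) h.
        flat_solvmanifold Q h \<and> has_holonomy_group Q h (integer_mod_group (2 * (p * q)))"
      using ex[of True] \<open>odd p\<close> by (simp add: q_def)
  next
    assume "p = 2 \<and> k \<ge> 2"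
    then have "even q" by (simp add: q_def)
    then show "\<exists>(Q :: ((real^'n) set, real^'n) manifold) h.
        flat_solvmanifold Q h \<and> has_holonomy_group Q h (integer_mod_group (p * q))"
      using ex[of False] by simp
  qed
qed

end
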